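(* For any $n\ge 1$ and any two different parameter sequences $(\alpha_{2i})_{1\le i\le n}$, $(\alpha_{2i}')_{1\le i\le n}$ with $\alpha_{2i},\alpha_{2i}'\in\{0,1\}^{i-1}$, the 2-factors $\mathcal{C}_{2n+1}$ and $\mathcal{C}_{2n+1}'$ obtained from the construction described in the context for these two parameter sequences, respectively, are different subgraphs of $Q_{2n+1}(n,n+1)$.
   Context: Bitstrings and layers. $B_n=\{0,1\}^n$, and $B_n(k)\subseteq B_n$ is the set of bitstrings with exactly $k$ entries equal to 1. For $0\le k\le n-1$, $Q_n(k,k+1)$ is the graph with vertex set $B_n(k)\cup B_n(k+1)$ in which two vertices are adjacent iff they differ in exactly one bit. $x\circ y$ denotes concatenation of bitstrings; for a graph, path, set of bitstrings, or family of graphs/paths $X$, $X\circ y$ is obtained by appending $y$ to every bitstring (vertex) involved. $\overline{x}$ is the bitwise complement of $x$, and $\mathrm{rev}(x)$ is the reversed bitstring. A 2-factor of a graph is a 2-regular spanning subgraph. For an oriented path $P=(v_1,\ldots,v_l)$ let $F(P)=v_1$, $S(P)=v_2$, $L(P)=v_l$; for a family $\mathcal{P}$ of oriented paths, $F(\mathcal{P})=\{F(P)\mid P\in\mathcal{P}\}$, and similarly $S(\mathcal{P})$, $L(\mathcal{P})$. Maps $f_\alpha$. For $\alpha\in\{0,1\}^{n-1}$, $\pi_\alpha:B_{2n}\to B_{2n}$ swaps the bits at positions $2i$ and $2i+1$ for exactly those $i\in\{1,\ldots,n-1\}$ with $\alpha(i)=1$, leaving everything else unchanged; $f_\alpha(x):=\overline{\mathrm{rev}(\pi_\alpha(x))}$.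 It is applied to paths vertex by vertex and is an isomorphism from $Q_{2n}(n,n+1)$ to $Q_{2n}(n-1,n)$. Construction. Given parameters $\alpha_{2i}\in\{0,1\}^{i-1}$, define families of pairwise disjoint oriented paths $\mathcal{P}_{2n}(k,k+1)$ in $Q_{2n}(k,k+1)$, $k=n,\ldots,2n-1$, starting and ending in $B_{2n}(k)$ (depending on $\alpha_2,\ldots,\alpha_{2n-2}$), and 2-factors $\mathcal{C}_{2n+1}$ of $Q_{2n+1}(n,n+1)$ (depending on $\alpha_2,\ldots,\alpha_{2n}$). Base: $\mathcal{P}_2(1,2):=\{((1,0),(1,1),(0,1))\}$. 2-factor $\mathcal{C}_{2n+1}$: let $M_{2n+1}^{FL}$ be the set of edges $\{v\circ(0),v\circ(1)\}$ with $v\in F(\mathcal{P}_{2n}(n,n+1))\cup L(\mathcal{P}_{2n}(n,n+1))$, and let $$\mathcal{C}_{2n+1}:=\mathcal{P}_{2n}(n,n+1)\circ(0)\;\cup\; f_{\alpha_{2n}}(\mathcal{P}_{2n}(n,n+1))\circ(1)\;\cup\; M_{2n+1}^{FL}.$$ This is a 2-factor of $Q_{2n+1}(n,n+1)$, because the paths in $\mathcal{P}_{2n}(n,n+1)$ visit all vertices of $Q_{2n}(n,n+1)$ and $f_{\alpha_{2n}}$ maps each of $F(\mathcal{P}_{2n}(n,n+1))$ and $L(\mathcal{P}_{2n}(n,n+1))$ onto itself. Step $n\to n+1$: with the conventions $\mathcal{P}_{2n}(2n,2n+1):=\mathcal{P}_{2n}(2n+1,2n+2):=\emptyset$, for $k=n+2,\ldots,2n+1$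 let $$\mathcal{P}_{2n+2}(k,k+1):=\mathcal{P}_{2n}(k,k+1)\circ(0,0)\cup\mathcal{P}_{2n}(k-1,k)\circ(1,0)\cup\mathcal{P}_{2n}(k-1,k)\circ(0,1)\cup\mathcal{P}_{2n}(k-2,k-1)\circ(1,1).$$ Let $\mathcal{C}_{2n+1}^-$ be obtained from $\mathcal{C}_{2n+1}$ by deleting every edge $(F(P),S(P))\circ(0)$, $P\in\mathcal{P}_{2n}(n,n+1)$; its components are paths, each joining a vertex $S(P)\circ(0)$ to a vertex $F(P')\circ(0)$ for some $P,P'\in\mathcal{P}_{2n}(n,n+1)$. Let $M_{2n+2}^S$ be the set of edges $\{s\circ(0,0),s\circ(0,1)\}$ with $s\in S(\mathcal{P}_{2n}(n,n+1))$. Let $\mathcal{P}'_{2n+2}$ be the set of components of $M_{2n+2}^S\cup\mathcal{C}_{2n+1}^-\circ(1)$, which are paths, each oriented so that its first edge is its edge from $M_{2n+2}^S$ (directed from $s\circ(0,0)$ to $s\circ(0,1)$). Finally $$\mathcal{P}_{2n+2}(n+1,n+2):=\mathcal{P}_{2n}(n+1,n+2)\circ(0,0)\cup\mathcal{P}_{2n}(n,n+1)\circ(1,0)\cup\mathcal{P}'_{2n+2}.$$ *)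

theory Defs
  imports Main
begin

text \<open>Bitstrings are lists of type \<^typ>\<open>bool list\<close>, with \<^term>\<open>True\<close> for the bit 1 and
  \<^term>\<open>False\<close> for the bit 0; the leftmost bit (position 1) is the head of the list.\<close>

type_synonym bits = "bool list"

record 'a ugraph =
  verts :: "'a set"
  edges :: "'a set set"

definition graph_union :: "'a ugraph \<Rightarrow> 'a ugraph \<Rightarrow> 'a ugraph" where
  "graph_union G H = \<lparr>verts = verts G \<union> verts H, edges = edges G \<union> edges H\<rparr>"

definition delete_edges :: "'a ugraph \<Rightarrow> 'a set set \<Rightarrow> 'a ugraph" where
  "delete_edges G D = \<lparr>verts = verts G, edges = edges G - D\<rparr>"

definition map_graph :: "('a \<Rightarrow> 'b) \<Rightarrow> 'a ugraph \<Rightarrow> 'b ugraph" where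
  "map_graph g G = \<lparr>verts = g ` verts G, edges = (\<lambda>e. g ` e) ` edges G\<rparr>"

definition edge_graph :: "'a set set \<Rightarrow> 'a ugraph" where
  "edge_graph M = \<lparr>verts = \<Union>M, edges = M\<rparr>"

definition reachable :: "'a ugraph \<Rightarrow> 'a \<Rightarrow> 'a \<Rightarrow> bool" where
  "reachable G = (\<lambda>u v. {u, v} \<in> edges G)\<^sup>*\<^sup>*"

definition component_of :: "'a ugraph \<Rightarrow> 'a \<Rightarrow> 'a ugraph" where
  "component_of G v =
    \<lparr>verts = {w. reachable G v w}, edges = {e \<in> edges G. e \<subseteq> {w. reachable G v w}}\<rparr>"

definition components :: "'a ugraph \<Rightarrow> 'a ugraph set" where
  "components G = component_of G ` verts G"

text \<open>An oriented path is the list of its vertices in order.\<close>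

type_synonym 'a path = "'a list"

definition path_first :: "'a path \<Rightarrow> 'a" where "path_first p = p ! 0"
definition path_second :: "'a path \<Rightarrow> 'a" where "path_second p = p ! 1"
definition path_last :: "'a path \<Rightarrow> 'a" where "path_last p = last p"

definition path_graph :: "'a path \<Rightarrow> 'a ugraph" where
  "path_graph p = \<lparr>verts = set p, edges = {{p ! i, p ! Suc i} | i. Suc i < length p}\<rparr>"

definition family_graph :: "'a path set \<Rightarrow> 'a ugraph" where
  "family_graph \<P> =
    \<lparr>verts = (\<Union>p\<in>\<P>. verts (path_graph p)), edges = (\<Union>p\<in>\<P>. edges (path_graph p))\<rparr>"

definition append_family :: "bits path set \<Rightarrow> bits \<Rightarrow> bits path set" where
  "append_family \<P> y = map (\<lambda>v. v @ y) ` \<P>"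

definition append_graph :: "bits ugraph \<Rightarrow> bits \<Rightarrow> bits ugraph" where
  "append_graph G y = map_graph (\<lambda>v. v @ y) G"

text \<open>\<open>swap_pairs \<alpha>\<close> swaps the two entries of the \<open>i\<close>-th block of length 2 iff the \<open>i\<close>-th bit
  of \<open>\<alpha>\<close> is 1. In \<open>pi_map\<close> the first bit is split off, so the \<open>i\<close>-th block of the remaining list
  consists of the positions \<open>2i\<close> and \<open>2i + 1\<close>. For \<open>\<alpha>\<close> of length \<open>n - 1\<close> and a bitstring of
  length \<open>2n\<close>, the position \<open>2n\<close> is left over and remains unchanged.\<close>

fun swap_pairs :: "bits \<Rightarrow> bits \<Rightarrow> bits" where
  "swap_pairs (a # \<alpha>) (x # y # zs) = (if a then y # x # swap_pairs \<alpha> zs else x # y # swap_pairs \<alpha> zs)"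
| "swap_pairs _ zs = zs"

fun pi_map :: "bits \<Rightarrow> bits \<Rightarrow> bits" where
  "pi_map \<alpha> (x # xs) = x # swap_pairs \<alpha> xs"
| "pi_map \<alpha> [] = []"

definition f_map :: "bits \<Rightarrow> bits \<Rightarrow> bits" where
  "f_map \<alpha> x = map Not (rev (pi_map \<alpha> x))"

definition M_FL :: "bits path set \<Rightarrow> bits set set" where
  "M_FL \<P> = {{v @ [False], v @ [True]} | v. v \<in> path_first ` \<P> \<union> path_last ` \<P>}"

definition M_S :: "bits path set \<Rightarrow> bits set set" where
  "M_S \<P> = {{s @ [False, False], s @ [False, True]} | s. s \<in> path_second ` \<P>}"

text \<open>In the following three definitions \<open>\<P>\<close> plays the role of the family
  \<open>\<P>\<^sub>2\<^sub>n(n, n+1)\<close> and \<open>\<alpha>\<close> that of the parameter \<open>\<alpha>\<^sub>2\<^sub>n\<close>; the results are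
  \<open>\<C>\<^sub>2\<^sub>n\<^sub>+\<^sub>1\<close>, its subgraph \<open>\<C>\<^sup>-\<^sub>2\<^sub>n\<^sub>+\<^sub>1\<close> and the family \<open>\<P>'\<^sub>2\<^sub>n\<^sub>+\<^sub>2\<close>.\<close>

definition factor_of :: "bits \<Rightarrow> bits path set \<Rightarrow> bits ugraph" where
  "factor_of \<alpha> \<P> =
    graph_union (family_graph (append_family \<P> [False]))
      (graph_union (family_graph (append_family (map (f_map \<alpha>) ` \<P>) [True]))
        (edge_graph (M_FL \<P>)))"

definition factor_minus_of :: "bits \<Rightarrow> bits path set \<Rightarrow> bits ugraph" where
  "factor_minus_of \<alpha> \<P> =
    delete_edges (factor_of \<alpha> \<P>) {{path_first p @ [False], path_second p @ [False]} | p. p \<in> \<P>}"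

text \<open>A distinct list whose path graph is a connected component enumerates that component from
  one end to the other; the last two conditions select the orientation.\<close>

definition new_paths_of :: "bits \<Rightarrow> bits path set \<Rightarrow> bits path set" where
  "new_paths_of \<alpha> \<P> =
    {p. distinct p \<and> 2 \<le> length p \<and>
        path_graph p \<in>
          components (graph_union (edge_graph (M_S \<P>)) (append_graph (factor_minus_of \<alpha> \<P>) [True])) \<and>
        (\<exists>s \<in> path_second ` \<P>. path_first p = s @ [False, False] \<and> path_second p = s @ [False, True])}"

text \<open>A parameter sequence is a function on the indices \<open>2, 4, ..., 2n\<close>, the value \<open>\<alpha> (2 * i)\<close>
  being the bitstring \<open>\<alpha>\<^sub>2\<^sub>i\<close>. Values at other indices are never used.\<close>

definition parameter_sequence :: "nat \<Rightarrow> (nat \<Rightarrow> bits) \<Rightarrow> bool" where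
  "parameter_sequence n \<alpha> \<longleftrightarrow> (\<forall>i\<in>{1..n}. length (\<alpha> (2 * i)) = i - 1)"

text \<open>\<open>path_family \<alpha> n k\<close> is \<open>\<P>\<^sub>2\<^sub>n(k, k+1)\<close> for \<open>n \<ge> 1\<close>; the equation for \<open>n = 0\<close> is a dummy.
  For all \<open>k\<close> outside the range \<open>n, ..., 2n - 1\<close> the value is the empty family, which
  includes the conventions for \<open>k = 2n\<close> and \<open>k = 2n + 1\<close>.\<close>

fun path_family :: "(nat \<Rightarrow> bits) \<Rightarrow> nat \<Rightarrow> nat \<Rightarrow> bits path set" where
  "path_family \<alpha> 0 k = {}"
| "path_family \<alpha> (Suc 0) k = (if k = 1 then {[[True, False], [True, True], [False, True]]} else {})"
| "path_family \<alpha> (Suc (Suc m)) k =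
    (let n = Suc m in
      if k = n + 1 then
        append_family (path_family \<alpha> n (n + 1)) [False, False] \<union>
        append_family (path_family \<alpha> n n) [True, False] \<union>
        new_paths_of (\<alpha> (2 * n)) (path_family \<alpha> n n)
      else if n + 2 \<le> k \<and> k \<le> 2 * n + 1 then
        append_family (path_family \<alpha> n k) [False, False] \<union>
        append_family (path_family \<alpha> n (k - 1)) [True, False] \<union>
        append_family (path_family \<alpha> n (k - 1)) [False, True] \<union>
        append_family (path_family \<alpha> n (k - 2)) [True, True]
      else {})"

definition two_factor :: "(nat \<Rightarrow> bits) \<Rightarrow> nat \<Rightarrow> bits ugraph" where
  "two_factor \<alpha> n = factor_of (\<alpha> (2 * n)) (path_family \<alpha> n n)"

end

theory Submission
  imports Defs
begin

text \<open>Reading bitstrings as lattice paths, the sets of first, second and last vertices of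
  \<open>\<P>\<^sub>2\<^sub>n(k, k+1)\<close> do not depend on the parameters, and every \<open>f\<^sub>\<alpha>\<close> maps the sets
  of first and last vertices for \<open>k = n\<close> onto themselves. Hence \<open>\<P>'\<^sub>2\<^sub>n\<^sub>+\<^sub>2\<close> can be written
  down explicitly: each of its paths runs through one path of \<open>\<P>\<^sub>2\<^sub>n(n, n+1)\<close> and then backwards
  through the \<open>f\<^sub>\<alpha>\<close>-image of another one.

  Consequently, if \<open>E\<close> is the edge set of \<open>\<P>\<^sub>2\<^sub>n(n, n+1)\<close>, then the edges of
  \<open>\<P>\<^sub>2\<^sub>n\<^sub>+\<^sub>2(n+1, n+2)\<close> with both ends having suffix 10 are a copy of \<open>E\<close>, and those with
  suffix 11 a copy of \<open>f\<^sub>\<alpha>(E)\<close>. So all parameters can be recovered inductively once \<open>f\<^sub>\<alpha>(E) = f\<^sub>\<beta>(E)\<close> implies \<open>\<alpha> = \<beta>\<close>. For this rigidity,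
  restriction to the suffix 10 reduces all bits of the parameter but the last one to the previous
  stage. If the last bits differ, take an edge joining \<open>s00\<close> to \<open>s01\<close> with \<open>s\<close> in \<open>S\<close> ending in 1: swapping the
  last bit of \<open>s\<close> with the following 0 yields a pair with suffixes 10 and 11, which is never an edge.\<close>

section \<open>Paths and components\<close>

abbreviation path_edges :: "'a path \<Rightarrow> 'a set set" where
  "path_edges p \<equiv> edges (path_graph p)"

abbreviation family_edges :: "'a path set \<Rightarrow> 'a set set" where
  "family_edges \<P> \<equiv> edges (family_graph \<P>)"

abbreviation suffix_image :: "bits \<Rightarrow> bits set \<Rightarrow> bits set" where
  "suffix_image y e \<equiv> (\<lambda>v. v @ y) ` e"

section \<open>Edge sets of vertex lists and families of disjoint paths\<close>

lemma path_edges_Nil [simp]: "path_edges [] = {}"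
  and path_edges_single [simp]: "path_edges [x] = {}"
  by (auto simp: path_graph_def)

lemma path_edges_Cons [simp]:
  "path_edges (x # y # zs) = insert {x, y} (path_edges (y # zs))"
proof -
  have "{i. Suc i < length (x # y # zs)} = insert 0 (Suc ` {i. Suc i < length (y # zs)})"
    by (auto simp: image_iff less_Suc_eq_0_disj)
  then have "(\<lambda>i. {(x # y # zs) ! i, (x # y # zs) ! Suc i}) ` {i. Suc i < length (x # y # zs)}
      = insert {x, y} ((\<lambda>i. {(y # zs) ! i, (y # zs) ! Suc i}) ` {i. Suc i < length (y # zs)})"
    by (simp add: image_image)
  then show ?thesis
    by (simp add: path_graph_def setcompr_eq_image)
qed

lemma verts_path_graph [simp]: "verts (path_graph p) = set p"
  by (simp add: path_graph_def)

lemma path_edges_append: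
  assumes "p \<noteq> []" "q \<noteq> []"
  shows "path_edges (p @ q) = insert {last p, hd q} (path_edges p \<union> path_edges q)"
  using assms
proof (induction p rule: induct_list012)
  case (2 x)
  then show ?case by (cases q) auto
qed auto

lemma path_edges_rev [simp]: "path_edges (rev p) = path_edges p"
proof (induction p rule: induct_list012)
  case (3 x y zs)
  have "path_edges (rev (x # y # zs)) = path_edges (rev (y # zs) @ [x])" by simp
  also have "\<dots> = insert {y, x} (path_edges (rev (y # zs)))"
    by (subst path_edges_append) auto
  finally show ?case using 3 by (simp add: insert_commute)
qed auto

lemma path_edges_map [simp]: "path_edges (map g p) = (`) g ` path_edges p"
  by (induction p rule: induct_list012) auto

lemma path_edges_doubleton:
  assumes "e \<in> path_edges p"
  shows "\<exists>u v. e = {u, v} \<and> u \<in> set p \<and> v \<in> set p"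
proof -
  obtain i where i: "Suc i < length p" "e = {p ! i, p ! Suc i}"
    using assms by (auto simp: path_graph_def)
  then have "p ! i \<in> set p" "p ! Suc i \<in> set p" by simp_all
  then show ?thesis using i(2) by blast
qed

lemma path_edges_subset: "e \<in> path_edges p \<Longrightarrow> e \<subseteq> set p"
  by (drule path_edges_doubleton) auto

lemma path_edges_nonempty: "e \<in> path_edges p \<Longrightarrow> e \<noteq> {}"
  by (drule path_edges_doubleton) auto

text \<open>A path graph forgets the direction of the list; fixing the first vertex restores it.
  Once the entries up to position \<open>j\<close> agree, the edge of \<open>p\<close> leaving
  \<open>p ! j\<close> must be one of the edges of \<open>q\<close> at that vertex, and the backward
  one would make \<open>p\<close> revisit an earlier vertex.\<close>

lemma path_graph_eq_imp_eq:
  assumes "path_graph p = path_graph q" "distinct p" "distinct q" "p ! 0 = q ! 0"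
  shows "p = q"
proof -
  have "set p = set q"
    using arg_cong[OF assms(1), of verts] by simp
  then have len: "length p = length q"
    using assms(2,3) by (metis distinct_card)
  have edges: "path_edges p = path_edges q"
    using assms(1) by simp
  have "i < length p \<longrightarrow> p ! i = q ! i" for i
  proof (induction i rule: less_induct)
    case (less i)
    show ?case
    proof (cases i)
      case 0
      then show ?thesis using assms(4) by simp
    next
      case (Suc j)
      show ?thesis
      proof
        assume i: "i < length p"
        have "{p ! j, p ! Suc j} \<in> path_edges p"
          using i Suc by (auto simp: path_graph_def)
        then obtain m where m: "Suc m < length q" "{p ! j, p ! Suc j} = {q ! m, q ! Suc m}"
          unfolding edges by (auto simp: path_graph_def)
        have pj: "p ! j = q ! j" using less Suc i by auto
        have "j = m \<or> j = Suc m"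
          using m pj assms(3) i len Suc
          by (metis Suc_lessD doubleton_eq_iff nth_eq_iff_index_eq)
        then show "p ! i = q ! i"
        proof
          assume "j = m"
          then show ?thesis using m pj Suc by (metis doubleton_eq_iff)
        next
          assume "j = Suc m"
          then have "p ! Suc j = q ! m"
            using m pj by (metis doubleton_eq_iff)
          also have "q ! m = p ! m"
            using less[of m] Suc \<open>j = Suc m\<close> i by auto
          finally have False
            using assms(2) i Suc \<open>j = Suc m\<close> by (simp add: nth_eq_iff_index_eq)
          then show ?thesis ..
        qed
      qed
    qed
  qed
  then show ?thesis using len by (simp add: nth_equalityI)
qed

text \<open>Disjointness is phrased as equality of paths that meet, the form in which it is used
  below. Length at least 2 makes \<open>p ! 1\<close> a genuine second vertex.\<close>

definition path_system :: "'a path set \<Rightarrow> bool" where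
  "path_system \<P> \<longleftrightarrow> (\<forall>p\<in>\<P>. distinct p \<and> 2 \<le> length p) \<and>
    (\<forall>p\<in>\<P>. \<forall>q\<in>\<P>. set p \<inter> set q \<noteq> {} \<longrightarrow> p = q)"

lemma path_system_distinct: "path_system \<P> \<Longrightarrow> p \<in> \<P> \<Longrightarrow> distinct p"
  and path_system_length: "path_system \<P> \<Longrightarrow> p \<in> \<P> \<Longrightarrow> 2 \<le> length p"
  and path_system_eqI:
    "path_system \<P> \<Longrightarrow> p \<in> \<P> \<Longrightarrow> q \<in> \<P> \<Longrightarrow> v \<in> set p \<Longrightarrow> v \<in> set q \<Longrightarrow> p = q"
  by (auto simp: path_system_def)

lemma path_system_nonempty: "path_system \<P> \<Longrightarrow> p \<in> \<P> \<Longrightarrow> p \<noteq> []"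
  by (drule (1) path_system_length) auto

text \<open>By disjointness a first vertex lies on its own path only, and there it occurs just
  once.\<close>

lemma path_system_hd_not_in_tl:
  assumes "path_system \<P>" "p \<in> \<P>" "q \<in> \<P>"
  shows "hd p \<notin> set (tl q)"
proof
  assume hq: "hd p \<in> set (tl q)"
  have "p \<noteq> []" using assms path_system_nonempty by blast
  then have "p = q"
    using assms hq path_system_eqI by (metis list.set_sel(1,2) tl_Nil)
  then show False
    using hq path_system_distinct[OF assms(1,2)] \<open>p \<noteq> []\<close> by (cases q) auto
qed

lemma path_system_Un:
  assumes "path_system \<P>" "path_system \<Q>"
    and "\<And>p q. p \<in> \<P> \<Longrightarrow> q \<in> \<Q> \<Longrightarrow> set p \<inter> set q = {}"
  shows "path_system (\<P> \<union> \<Q>)"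
  unfolding path_system_def
proof (intro conjI ballI impI)
  fix p q assume "p \<in> \<P> \<union> \<Q>" "q \<in> \<P> \<union> \<Q>" "set p \<inter> set q \<noteq> {}"
  then show "p = q"
    using assms unfolding path_system_def by (metis Int_commute UnE)
qed (use assms in \<open>auto simp: path_system_def\<close>)

lemma path_system_append_family:
  assumes "path_system \<P>"
  shows "path_system (append_family \<P> y)"
proof -
  have "map (\<lambda>v. v @ y) p = map (\<lambda>v. v @ y) q"
    if "p \<in> \<P>" "q \<in> \<P>" "set (map (\<lambda>v. v @ y) p) \<inter> set (map (\<lambda>v. v @ y) q) \<noteq> {}" for p q
  proof -
    have "p = q" using that assms unfolding path_system_def by auto
    then show ?thesis by simp
  qed
  then show ?thesis
    using assms unfolding path_system_def append_family_def
    by (auto simp: distinct_map inj_on_def)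
qed

lemma family_edges_iff: "e \<in> family_edges \<P> \<longleftrightarrow> (\<exists>p\<in>\<P>. e \<in> path_edges p)"
  by (simp add: family_graph_def)

lemma family_edges_Un: "family_edges (\<P> \<union> \<Q>) = family_edges \<P> \<union> family_edges \<Q>"
  by (simp add: family_graph_def)

lemma family_edges_map: "family_edges (map g ` \<P>) = (`) g ` family_edges \<P>"
  by (simp add: family_graph_def image_UN)

lemma family_edges_append: "family_edges (append_family \<P> y) = suffix_image y ` family_edges \<P>"
  unfolding append_family_def by (rule family_edges_map)

lemma family_edges_nonempty: "e \<in> family_edges \<P> \<Longrightarrow> e \<noteq> {}"
  unfolding family_edges_iff by (elim bexE) (rule path_edges_nonempty)

section \<open>Reachability and components of a union of disjoint paths\<close>

lemma reachable_sym: "reachable G u v \<Longrightarrow> reachable G v u"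
  unfolding reachable_def
proof (induction rule: rtranclp_induct)
  case (step y z)
  then have "{z, y} \<in> edges G" by (simp add: insert_commute)
  then show ?case using step.IH by (rule converse_rtranclp_into_rtranclp)
qed simp

lemma reachable_trans: "reachable G u v \<Longrightarrow> reachable G v w \<Longrightarrow> reachable G u w"
  unfolding reachable_def by auto

lemma reachable_hd:
  assumes "path_edges p \<subseteq> edges G" "v \<in> set p"
  shows "reachable G (hd p) v"
  using assms
proof (induction p rule: induct_list012)
  case (3 x y zs)
  show ?case
  proof (cases "v = x")
    case True
    then show ?thesis by (simp add: reachable_def)
  next
    case False
    then have "reachable G y v" using 3 by auto
    moreover have "reachable G x y" using 3 by (auto simp: reachable_def)
    ultimately show ?thesis using reachable_trans by fastforce
  qed
qed (auto simp: reachable_def)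

text \<open>A walk cannot leave \<open>p\<close>, since a path sharing a vertex with
  \<open>p\<close> is \<open>p\<close> itself. The same argument, applied to an end of an edge
  inside \<open>set p\<close>, shows that the component has no further edges.\<close>

lemma component_of_family_graph:
  assumes "path_system \<P>" "p \<in> \<P>" "v \<in> set p"
  shows "component_of (family_graph \<P>) v = path_graph p"
proof -
  let ?G = "family_graph \<P>"
  have sub: "path_edges p \<subseteq> edges ?G"
    using assms(2) by (auto simp: family_graph_def)
  have "w \<in> set p" if "reachable ?G v w" for w
    using that unfolding reachable_def
  proof (induction rule: rtranclp_induct)
    case base
    show ?case by fact
  next
    case (step u w)
    then obtain q where q: "q \<in> \<P>" "{u, w} \<in> path_edges q"
      by (auto simp: family_edges_iff)
    then have "u \<in> set q" "w \<in> set q"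
      using path_edges_subset by fastforce+
    then show ?case using path_system_eqI[OF assms(1,2) q(1)] step by blast
  qed
  moreover have "reachable ?G v w" if "w \<in> set p" for w
    using reachable_hd[OF sub assms(3)] reachable_hd[OF sub that]
    by (meson reachable_sym reachable_trans)
  ultimately have reach: "{w. reachable ?G v w} = set p" by blast
  have "e \<in> path_edges p" if e: "e \<in> edges ?G" "e \<subseteq> set p" for e
  proof -
    obtain q where q: "q \<in> \<P>" "e \<in> path_edges q"
      using e(1) unfolding family_edges_iff by blast
    obtain u where "u \<in> e" using path_edges_nonempty[OF q(2)] by blast
    then have "p = q"
      using path_system_eqI[OF assms(1,2) q(1)] path_edges_subset[OF q(2)] e by blast
    then show ?thesis using q by simp
  qed
  then have "{e \<in> edges ?G. e \<subseteq> set p} = path_edges p"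
    using sub path_edges_subset by blast
  then show ?thesis
    unfolding component_of_def reach by (simp add: path_graph_def)
qed

text \<open>Reduces finding the components in \<open>new_paths_of\<close> to writing its graph as
  the union of an explicit path system.\<close>

lemma components_family_graph:
  assumes "path_system \<P>"
  shows "components (family_graph \<P>) = path_graph ` \<P>"
proof (intro equalityI subsetI)
  fix C assume "C \<in> components (family_graph \<P>)"
  then show "C \<in> path_graph ` \<P>"
    using component_of_family_graph[OF assms]
    by (auto simp: components_def family_graph_def)
next
  fix C assume "C \<in> path_graph ` \<P>"
  then obtain p where p: "p \<in> \<P>" "C = path_graph p" by blast
  have "hd p \<in> set p" using path_system_nonempty[OF assms p(1)] by simp
  then show "C \<in> components (family_graph \<P>)"
    unfolding components_def using component_of_family_graph[OF assms p(1)] p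
    by (force simp: family_graph_def)
qed

section \<open>Lattice paths\<close>

lemma swap_pairs_involution [simp]: "swap_pairs \<alpha> (swap_pairs \<alpha> zs) = zs"
  by (induction \<alpha> zs rule: swap_pairs.induct) auto

lemma pi_map_involution [simp]: "pi_map \<alpha> (pi_map \<alpha> x) = x"
  by (cases x) auto

lemma length_swap_pairs [simp]: "length (swap_pairs \<alpha> zs) = length zs"
  by (induction \<alpha> zs rule: swap_pairs.induct) auto

lemma length_pi_map [simp]: "length (pi_map \<alpha> x) = length x"
  by (cases x) auto

lemma inj_pi_map: "inj (pi_map \<alpha>)"
  by (metis injI pi_map_involution)

lemma inj_map_Not_rev: "inj (\<lambda>x. map Not (rev x))"
proof (rule injI)
  fix x y :: bits assume "map Not (rev x) = map Not (rev y)"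
  moreover have "map Not (map Not z) = z" for z by (induction z) auto
  ultimately show "x = y" by (metis rev_rev_ident)
qed

lemma inj_f_map: "inj (f_map \<alpha>)"
  using inj_map_Not_rev inj_pi_map by (auto simp: f_map_def inj_def)

lemma length_f_map [simp]: "length (f_map \<alpha> x) = length x"
  by (simp add: f_map_def)

text \<open>A word of length \<open>2 * n\<close> with \<open>k\<close> ones has height
  \<open>2 * (k - n)\<close>; below, layers are expressed by heights.\<close>

definition height :: "bits \<Rightarrow> int" where
  "height x = (\<Sum>b\<leftarrow>x. if b then 1 else - 1)"

lemma height_simps [simp]:
  "height [] = 0"
  "height (b # x) = (if b then 1 else - 1) + height x"
  "height (x @ y) = height x + height y"
  "height (rev x) = height x"
  by (simp_all add: height_def rev_map[symmetric])

lemma height_map_Not [simp]: "height (map Not x) = - height x"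
  by (induction x) auto

lemma even_height: "even (height x) \<longleftrightarrow> even (length x)"
  by (induction x) auto

text \<open>A swap exchanges bits within a block, so prefixes made of whole blocks keep their
  height. As \<open>pi_map\<close> splits off the first bit, these block boundaries become the odd
  positions.\<close>

lemma height_take_swap_pairs: "height (take (2 * i) (swap_pairs \<alpha> zs)) = height (take (2 * i) zs)"
proof (induction \<alpha> zs arbitrary: i rule: swap_pairs.induct)
  case (1 a \<alpha> x y zs)
  then show ?case by (cases i) auto
qed auto

lemma height_take_pi_map:
  "height (take (Suc (2 * i)) (pi_map \<alpha> x)) = height (take (Suc (2 * i)) x)"
  using height_take_swap_pairs by (cases x) auto

lemma height_swap_pairs [simp]: "height (swap_pairs \<alpha> zs) = height zs"
  by (induction \<alpha> zs rule: swap_pairs.induct) auto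

lemma height_pi_map [simp]: "height (pi_map \<alpha> x) = height x"
  by (cases x) auto

lemma height_f_map [simp]: "height (f_map \<alpha> x) = - height x"
  by (simp add: f_map_def)

definition dips :: "bits \<Rightarrow> nat set" where
  "dips x = {i. Suc (2 * i) \<le> length x \<and> height (take (Suc (2 * i)) x) < 0}"

definition positive :: "bits \<Rightarrow> bool" where
  "positive x \<longleftrightarrow> (\<forall>i. 1 \<le> i \<and> 2 * i \<le> length x \<longrightarrow> 0 < height (take (2 * i) x))"

lemma finite_dips: "finite (dips x)"
  by (rule finite_subset[of _ "{..length x}"]) (auto simp: dips_def)

lemma dips_Nil [simp]: "dips [] = {}"
  by (simp add: dips_def)

lemma positive_Nil [simp]: "positive []"
  by (simp add: positive_def)

text \<open>The one odd prefix gained is \<open>v\<close> followed by \<open>a\<close>; it has index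
  \<open>n\<close>.\<close>

lemma dips_snoc2:
  assumes "length v = 2 * n"
  shows "dips (v @ [a, b]) = dips v \<union> (if height v + (if a then 1 else - 1) < 0 then {n} else {})"
proof -
  have "Suc (2 * i) \<le> Suc (Suc (2 * n)) \<longleftrightarrow> Suc (2 * i) \<le> 2 * n \<or> i = n" for i by presburger
  then show ?thesis using assms by (auto simp: dips_def)
qed

lemma dips_less: "length v = 2 * n \<Longrightarrow> n \<notin> dips v"
  by (auto simp: dips_def)

lemma positive_snoc2:
  assumes "length v = 2 * n"
  shows "positive (v @ [a, b]) \<longleftrightarrow> positive v \<and> 0 < height (v @ [a, b])"
proof -
  have "1 \<le> i \<and> 2 * i \<le> Suc (Suc (2 * n)) \<longleftrightarrow> 1 \<le> i \<and> 2 * i \<le> 2 * n \<or> i = Suc n" for i by presburger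
  then show ?thesis using assms by (auto simp: positive_def)
qed

lemma snoc2_cases:
  assumes "length x = 2 * Suc n"
  obtains v a b where "x = v @ [a, b]" "length v = 2 * n"
proof -
  obtain w b where w: "x = w @ [b]"
    using assms by (cases x rule: rev_cases) auto
  then obtain v a where "w = v @ [a]"
    using assms by (cases w rule: rev_cases) auto
  then show thesis using that assms w by simp
qed

lemma positive_imp_height: "positive v \<Longrightarrow> length v = 2 * n \<Longrightarrow> n \<ge> 1 \<Longrightarrow> height v > 0"
  by (auto simp: positive_def)

text \<open>Positive even heights are at least 2, so the odd position one step earlier has height at
  least 1.\<close>

lemma positive_imp_dips: "length v = 2 * n \<Longrightarrow> positive v \<Longrightarrow> dips v = {}"
proof (induction n arbitrary: v)
  case (Suc n)
  obtain w a b where w: "v = w @ [a, b]" "length w = 2 * n"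
    using snoc2_cases[OF Suc.prems(1)] .
  have pos: "positive w" "0 < height (w @ [a, b])"
    using Suc.prems positive_snoc2[OF w(2)] w by auto
  have "even (height w)" using even_height w by simp
  then have "0 \<le> height w + (if a then 1 else - 1)"
    using pos by (auto split: if_splits elim!: evenE)
  then show ?case using Suc.IH[OF w(2) pos(1)] dips_snoc2[OF w(2)] w by auto
qed simp

text \<open>The last odd height is non-negative and odd, hence at least 1, and only one step
  follows.\<close>

lemma dips_empty_imp_height: "length v = 2 * n \<Longrightarrow> dips v = {} \<Longrightarrow> height v \<ge> 0"
proof (cases n)
  case (Suc m)
  assume v: "length v = 2 * n" "dips v = {}"
  obtain w a b where w: "v = w @ [a, b]" "length w = 2 * m"
    using snoc2_cases[of v m] v Suc by blast
  have "even (height w)" using even_height w by simp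
  then show ?thesis using v(2) dips_snoc2[OF w(2), of a b] w
    by (auto split: if_splits elim!: evenE)
qed auto

text \<open>Only heights at odd positions enter here: they are unchanged by \<^const>\<open>pi_map\<close>, while
  the reversed complement of a word of height 0 has the same heights in reverse order.\<close>

lemma card_dips_f_map:
  assumes "length x = 2 * n" "height x = 0"
  shows "card (dips (f_map \<alpha> x)) = card (dips x)"
proof -
  let ?y = "pi_map \<alpha> x"
  have y: "length ?y = 2 * n" "height ?y = 0" using assms by auto
  have odd_height: "height (take (Suc (2 * i)) (f_map \<alpha> x)) = height (take (Suc (2 * (n - Suc i))) x)"
    if "i < n" for i
  proof -
    have e: "2 * n - Suc (2 * i) = Suc (2 * (n - Suc i))" using that by simp
    have "height (take (Suc (2 * i)) (f_map \<alpha> x)) = - height (drop (2 * n - Suc (2 * i)) ?y)"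
      using y by (simp add: f_map_def take_map take_rev)
    also have "\<dots> = height (take (2 * n - Suc (2 * i)) ?y)"
      using y(2) by (metis append_take_drop_id height_simps(3) neg_eq_iff_add_eq_0 add.commute)
    finally show ?thesis by (simp add: e height_take_pi_map)
  qed
  \<comment> \<open>Reversal takes the prefix length \<open>2 * i + 1\<close> to
    \<open>2 * n - (2 * i + 1)\<close>, which is \<open>2 * j + 1\<close> for
    \<open>j = n - Suc i\<close>.\<close>
  have "bij_betw (\<lambda>i. n - Suc i) (dips (f_map \<alpha> x)) (dips x)"
    by (rule bij_betw_byWitness[where f' = "\<lambda>i. n - Suc i"])
      (use assms odd_height in \<open>auto simp: dips_def\<close>)
  then show ?thesis by (rule bij_betw_same_card)
qed

text \<open>The sets \<open>F\<close>, \<open>S\<close> and \<open>L\<close> of \<open>\<P>\<^sub>2\<^sub>n(k, k+1)\<close>, read as lattice paths (1 is an up-step):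
  non-negative paths returning to 0, paths positive after the start, and paths that visit \<open>-1\<close>
  exactly once. The first two sets need only the even positions and the dips only the odd ones,
  because heights at odd positions are odd.\<close>

definition first_set :: "nat \<Rightarrow> nat \<Rightarrow> bits set" where
  "first_set n k = {x. length x = 2 * n \<and> height x = 2 * (int k - int n) \<and> dips x = {} \<and> \<not> positive x}"

definition second_set :: "nat \<Rightarrow> nat \<Rightarrow> bits set" where
  "second_set n k = {x. length x = 2 * n \<and> height x = 2 * (int k + 1 - int n) \<and> positive x}"

definition last_set :: "nat \<Rightarrow> nat \<Rightarrow> bits set" where
  "last_set n k = {x. length x = 2 * n \<and> height x = 2 * (int k - int n) \<and> card (dips x) = 1}"

section \<open>Splitting the three vertex sets by the last two bits\<close>

lemma set_eq_snoc2I: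
  assumes "\<And>x. x \<in> A \<Longrightarrow> length x = 2 * Suc n" "\<And>x. x \<in> B \<Longrightarrow> length x = 2 * Suc n"
    and "\<And>v a b. length v = 2 * n \<Longrightarrow> v @ [a, b] \<in> A \<longleftrightarrow> v @ [a, b] \<in> B"
  shows "A = B"
  using assms by (metis snoc2_cases subsetI subset_antisym)

lemma snoc2_in_suffix_image [simp]:
  "v @ [a, b] \<in> suffix_image [c, d] A \<longleftrightarrow> v \<in> A \<and> a = c \<and> b = d"
  by auto

lemma first_set_1: "first_set 1 k = (if k = 1 then {[True, False]} else {})"
proof -
  have "x \<in> first_set 1 k \<longleftrightarrow> k = 1 \<and> x = [True, False]" for x
  proof (cases "length x = 2 * Suc 0")
    case True
    obtain v a b where "x = v @ [a, b]" "length v = 2 * 0" using snoc2_cases[OF True] .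
    then show ?thesis
      using dips_snoc2[of v 0 a b] positive_snoc2[of v 0 a b]
      by (auto simp: first_set_def split: if_splits)
  qed (auto simp: first_set_def)
  then show ?thesis by auto
qed

lemma second_set_1: "second_set 1 k = (if k = 1 then {[True, True]} else {})"
proof -
  have "x \<in> second_set 1 k \<longleftrightarrow> k = 1 \<and> x = [True, True]" for x
  proof (cases "length x = 2 * Suc 0")
    case True
    obtain v a b where "x = v @ [a, b]" "length v = 2 * 0" using snoc2_cases[OF True] .
    then show ?thesis
      using positive_snoc2[of v 0 a b]
      by (auto simp: second_set_def split: if_splits)
  qed (auto simp: second_set_def)
  then show ?thesis by auto
qed

lemma last_set_1: "1 \<le> k \<Longrightarrow> last_set 1 k = (if k = 1 then {[False, True]} else {})"
proof -
  assume k: "1 \<le> k"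
  have "x \<in> last_set 1 k \<longleftrightarrow> k = 1 \<and> x = [False, True]" for x
  proof (cases "length x = 2 * Suc 0")
    case True
    obtain v a b where "x = v @ [a, b]" "length v = 2 * 0" using snoc2_cases[OF True] .
    then show ?thesis
      using k dips_snoc2[of v 0 a b] by (cases a; cases b) (auto simp: last_set_def)
  qed (auto simp: last_set_def)
  then show ?thesis by auto
qed

text \<open>Suffix 00 leaves a prefix of height 2 without dips, which either fails to be positive
  (\<open>first_set\<close>) or is positive (\<open>second_set\<close>); the latter words become the
  starts of the linked paths. Suffixes 01 and 11 force a dip.\<close>

lemma first_set_step:
  assumes "n \<ge> 1"
  shows "first_set (Suc n) (Suc n) = suffix_image [False, False] (first_set n (Suc n)) \<union>
    suffix_image [True, False] (first_set n n) \<union> suffix_image [False, False] (second_set n n)"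
proof (rule set_eq_snoc2I[where n = n])
  fix v :: bits and a b assume v: "length v = 2 * n"
  then show "v @ [a, b] \<in> first_set (Suc n) (Suc n) \<longleftrightarrow> v @ [a, b] \<in>
    suffix_image [False, False] (first_set n (Suc n)) \<union>
    suffix_image [True, False] (first_set n n) \<union> suffix_image [False, False] (second_set n n)"
    using assms dips_snoc2[OF v, of a b] positive_snoc2[OF v, of a b] positive_imp_dips[OF v]
      dips_empty_imp_height[OF v] positive_imp_height[OF _ v]
    by (auto simp: first_set_def second_set_def split: if_splits)
qed (auto simp: first_set_def second_set_def)

text \<open>Suffix 11 is missing because it would need a positive prefix of height 0.\<close>

lemma second_set_step:
  assumes "n \<ge> 1"
  shows "second_set (Suc n) (Suc n) = suffix_image [False, False] (second_set n (Suc n)) \<union>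
    suffix_image [True, False] (second_set n n) \<union> suffix_image [False, True] (second_set n n)"
proof (rule set_eq_snoc2I[where n = n])
  fix v :: bits and a b assume v: "length v = 2 * n"
  then show "v @ [a, b] \<in> second_set (Suc n) (Suc n) \<longleftrightarrow> v @ [a, b] \<in>
    suffix_image [False, False] (second_set n (Suc n)) \<union>
    suffix_image [True, False] (second_set n n) \<union> suffix_image [False, True] (second_set n n)"
    using assms positive_snoc2[OF v, of a b] positive_imp_height[OF _ v]
    by (auto simp: second_set_def split: if_splits)
qed (auto simp: second_set_def)

text \<open>With suffix 01 the single dip is at the end, so the prefix is a dip-free word of height
  0. Suffix 11 would follow a prefix of height -2, giving a second dip.\<close>

lemma last_set_step:
  assumes "n \<ge> 1"
  shows "last_set (Suc n) (Suc n) = suffix_image [False, False] (last_set n (Suc n)) \<union>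
    suffix_image [True, False] (last_set n n) \<union> suffix_image [False, True] (first_set n n)"
proof (rule set_eq_snoc2I[where n = n])
  fix v :: bits and a b assume v: "length v = 2 * n"
  then show "v @ [a, b] \<in> last_set (Suc n) (Suc n) \<longleftrightarrow> v @ [a, b] \<in>
    suffix_image [False, False] (last_set n (Suc n)) \<union>
    suffix_image [True, False] (last_set n n) \<union> suffix_image [False, True] (first_set n n)"
    using assms dips_snoc2[OF v, of a b] positive_imp_height[OF _ v]
      dips_empty_imp_height[OF v] dips_less[OF v] finite_dips[of v]
    by (auto simp: first_set_def last_set_def split: if_splits)
qed (auto simp: first_set_def last_set_def)

text \<open>Here the final height \<open>2 * (j + 1 - n)\<close> is positive, so the last two bits
  neither create a dip nor affect positivity. Therefore all four suffixes occur; the next two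
  splittings hold for the same reason.\<close>

lemma first_set_upper_step:
  assumes "n \<le> j"
  shows "first_set (Suc n) (Suc (Suc j)) = suffix_image [False, False] (first_set n (Suc (Suc j))) \<union>
    suffix_image [True, False] (first_set n (Suc j)) \<union>
    suffix_image [False, True] (first_set n (Suc j)) \<union> suffix_image [True, True] (first_set n j)"
  (is "_ = ?R")
proof (rule set_eq_snoc2I[where n = n])
  fix v :: bits and a b assume v: "length v = 2 * n"
  then show "v @ [a, b] \<in> first_set (Suc n) (Suc (Suc j)) \<longleftrightarrow> v @ [a, b] \<in> ?R"
    using assms dips_snoc2[OF v, of a b] positive_snoc2[OF v, of a b]
    by (cases a; cases b) (auto simp: first_set_def)
qed (auto simp: first_set_def)

lemma second_set_upper_step:
  assumes "n \<le> j"
  shows "second_set (Suc n) (Suc (Suc j)) = suffix_image [False, False] (second_set n (Suc (Suc j))) \<union>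
    suffix_image [True, False] (second_set n (Suc j)) \<union>
    suffix_image [False, True] (second_set n (Suc j)) \<union> suffix_image [True, True] (second_set n j)"
  (is "_ = ?R")
proof (rule set_eq_snoc2I[where n = n])
  fix v :: bits and a b assume v: "length v = 2 * n"
  then show "v @ [a, b] \<in> second_set (Suc n) (Suc (Suc j)) \<longleftrightarrow> v @ [a, b] \<in> ?R"
    using assms positive_snoc2[OF v, of a b]
    by (cases a; cases b) (auto simp: second_set_def)
qed (auto simp: second_set_def)

lemma last_set_upper_step:
  assumes "n \<le> j"
  shows "last_set (Suc n) (Suc (Suc j)) = suffix_image [False, False] (last_set n (Suc (Suc j))) \<union>
    suffix_image [True, False] (last_set n (Suc j)) \<union>
    suffix_image [False, True] (last_set n (Suc j)) \<union> suffix_image [True, True] (last_set n j)"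
  (is "_ = ?R")
proof (rule set_eq_snoc2I[where n = n])
  fix v :: bits and a b assume v: "length v = 2 * n"
  then show "v @ [a, b] \<in> last_set (Suc n) (Suc (Suc j)) \<longleftrightarrow> v @ [a, b] \<in> ?R"
    using assms dips_snoc2[OF v, of a b]
    by (cases a; cases b) (auto simp: last_set_def)
qed (auto simp: last_set_def)

section \<open>Invariance of the sets of first and last vertices under the maps f\<close>

lemma f_map_image_eq:
  assumes "\<And>x. x \<in> A \<Longrightarrow> f_map \<alpha> x \<in> A" "\<And>x. x \<in> A \<Longrightarrow> length x = m"
  shows "f_map \<alpha> ` A = A"
proof -
  have "finite A"
    using finite_lists_length_eq[of "UNIV :: bool set" m] assms(2)
    by (auto intro: finite_subset[rotated])
  moreover have "inj_on (f_map \<alpha>) A"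
    using inj_f_map inj_on_subset by blast
  ultimately show ?thesis using assms(1) endo_inj_surj by blast
qed

text \<open>\<open>card_dips_f_map\<close> transfers the absence of dips, and for
  \<open>n >= 1\<close> a word of height 0 is never positive.\<close>

lemma f_map_first_set:
  assumes "n \<ge> 1"
  shows "f_map \<alpha> ` first_set n n = first_set n n"
proof (rule f_map_image_eq)
  fix x assume x: "x \<in> first_set n n"
  then have "card (dips (f_map \<alpha> x)) = 0"
    using card_dips_f_map[of x n] by (simp add: first_set_def)
  then show "f_map \<alpha> x \<in> first_set n n"
    using x finite_dips assms positive_imp_height[of "f_map \<alpha> x" n] by (auto simp: first_set_def)
qed (auto simp: first_set_def)

lemma f_map_last_set: "f_map \<alpha> ` last_set n n = last_set n n"
proof (rule f_map_image_eq)
  fix x assume "x \<in> last_set n n"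
  then show "f_map \<alpha> x \<in> last_set n n"
    using card_dips_f_map[of x n] by (simp add: last_set_def)
qed (auto simp: last_set_def)

text \<open>Provides the witness for separating parameters with different last bits. Appending 01
  leads from each \<open>second_set\<close> to the next.\<close>

lemma second_set_ends_in_one: "\<exists>t. t @ [True] \<in> second_set (Suc n) (Suc n)"
proof (induction n)
  case 0
  have "[True] @ [True] \<in> second_set (Suc 0) (Suc 0)"
    using second_set_1[of 1] by simp
  then show ?case ..
next
  case (Suc n)
  then obtain t where "t @ [True] \<in> second_set (Suc n) (Suc n)" by blast
  then have "(t @ [True, False]) @ [True] \<in> second_set (Suc (Suc n)) (Suc (Suc n))"
    using second_set_step[of "Suc n"] by force
  then show ?case ..
qed

section \<open>The new paths\<close>

text \<open>The paths of \<open>\<P>'\<^sub>2\<^sub>n\<^sub>+\<^sub>2\<close>: the walk leaves \<open>P\<close> at its last vertex, passes to the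
  path \<open>f(Q)\<close> with the same last vertex, runs through it backwards, and stops at the
  vertex \<open>F(f(Q))\<close>, which is the first vertex of a path whose first edge has been deleted.\<close>

definition link :: "bits \<Rightarrow> bits path \<Rightarrow> bits path \<Rightarrow> bits path" where
  "link \<alpha> p q =
    [p ! 1 @ [False, False]] @ map (\<lambda>v. v @ [False, True]) (tl p) @
    map (\<lambda>v. v @ [True, True]) (rev (map (f_map \<alpha>) q)) @ [f_map \<alpha> (hd q) @ [False, True]]"

definition linked :: "bits \<Rightarrow> bits path set \<Rightarrow> bits path set" where
  "linked \<alpha> \<P> = {link \<alpha> p q | p q. p \<in> \<P> \<and> q \<in> \<P> \<and> f_map \<alpha> (last q) = last p}"

text \<open>The three explicit edges are the \<open>M_S\<close> edge at the start, the matching edge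
  at the common last vertex, and the matching edge at the first vertex of the image of
  \<open>q\<close>.\<close>

lemma path_edges_link:
  assumes "2 \<le> length p" "q \<noteq> []" "f_map \<alpha> (last q) = last p"
  shows "path_edges (link \<alpha> p q) =
    {{p ! 1 @ [False, False], p ! 1 @ [False, True]}, {last p @ [False, True], last p @ [True, True]},
     {f_map \<alpha> (hd q) @ [False, True], f_map \<alpha> (hd q) @ [True, True]}} \<union>
    suffix_image [False, True] ` path_edges (tl p) \<union>
    suffix_image [True, True] ` (`) (f_map \<alpha>) ` path_edges q"
proof -
  let ?a = "p ! 1 @ [False, False]" and ?b = "map (\<lambda>v. v @ [False, True]) (tl p)"
  let ?c = "map (\<lambda>v. v @ [True, True]) (rev (map (f_map \<alpha>) q))"
  let ?d = "f_map \<alpha> (hd q) @ [False, True]"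
  have tl: "tl p \<noteq> []" "hd (tl p) = p ! 1" "last (tl p) = last p"
    using assms(1) by (cases p; cases "tl p"; auto)+
  have "?b \<noteq> []" "?c \<noteq> []" using tl assms(2) by auto
  then have "path_edges (link \<alpha> p q) = insert {?a, hd ?b} (path_edges ?b \<union>
      insert {last ?b, hd ?c} (path_edges ?c \<union> {{last ?c, ?d}}))"
    unfolding link_def
    using path_edges_append[of "[?a]" "?b @ ?c @ [?d]"] path_edges_append[of ?b "?c @ [?d]"]
      path_edges_append[of ?c "[?d]"] by (simp add: Un_commute del: path_edges_map path_edges_Cons)
  moreover have "hd ?b = p ! 1 @ [False, True]" "last ?b = last p @ [False, True]"
    using tl by (simp_all add: hd_map last_map)
  moreover have "hd ?c = last p @ [True, True]" "last ?c = f_map \<alpha> (hd q) @ [True, True]"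
    using assms(2,3) by (simp_all add: hd_map last_map hd_rev last_rev)
  ultimately show ?thesis
    by (simp add: insert_commute Un_commute Un_left_commute)
qed

text \<open>Collects what linking needs from the middle family: disjoint paths whose sets of first
  and of last vertices are each mapped onto themselves.\<close>

locale compatible_system =
  fixes \<alpha> :: bits and \<P> :: "bits path set"
  assumes system: "path_system \<P>"
    and hd_invariant: "f_map \<alpha> ` hd ` \<P> = hd ` \<P>"
    and last_invariant: "f_map \<alpha> ` last ` \<P> = last ` \<P>"
begin

lemma nonempty: "p \<in> \<P> \<Longrightarrow> p \<noteq> []"
  using path_system_nonempty system .

lemma f_map_eq [simp]: "f_map \<alpha> x = f_map \<alpha> y \<longleftrightarrow> x = y"
  by (rule inj_eq[OF inj_f_map])

text \<open>Invariance pairs up paths in both directions, at last vertices as well as at first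
  vertices. The partners are unique by disjointness and injectivity.\<close>

lemma
  assumes "p \<in> \<P>"
  shows successor: "\<exists>q\<in>\<P>. f_map \<alpha> (last q) = last p"
    and predecessor: "\<exists>q\<in>\<P>. f_map \<alpha> (last p) = last q"
    and hd_successor: "\<exists>q\<in>\<P>. f_map \<alpha> (hd q) = hd p"
    and hd_predecessor: "\<exists>q\<in>\<P>. f_map \<alpha> (hd p) = hd q"
proof -
  have "last p \<in> f_map \<alpha> ` last ` \<P>" "f_map \<alpha> (last p) \<in> last ` \<P>"
    using assms last_invariant by blast+
  then show "\<exists>q\<in>\<P>. f_map \<alpha> (last q) = last p" "\<exists>q\<in>\<P>. f_map \<alpha> (last p) = last q"
    by auto
  have "hd p \<in> f_map \<alpha> ` hd ` \<P>" "f_map \<alpha> (hd p) \<in> hd ` \<P>"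
    using assms hd_invariant by blast+
  then show "\<exists>q\<in>\<P>. f_map \<alpha> (hd q) = hd p" "\<exists>q\<in>\<P>. f_map \<alpha> (hd p) = hd q"
    by auto
qed

lemma linked_cases:
  assumes "r \<in> linked \<alpha> \<P>"
  obtains p q where "p \<in> \<P>" "q \<in> \<P>" "f_map \<alpha> (last q) = last p" "r = link \<alpha> p q"
  using assms that unfolding linked_def mem_Collect_eq by (elim exE conjE) simp

lemma set_link:
  "set (link \<alpha> p q) = insert (p ! 1 @ [False, False])
    (suffix_image [False, True] (insert (f_map \<alpha> (hd q)) (set (tl p))) \<union>
     suffix_image [True, True] (f_map \<alpha> ` set q))"
  by (auto simp: link_def)

text \<open>By invariance \<open>f_map \<alpha> (hd q)\<close> is again a first vertex, and tails
  avoid those.\<close>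

lemma f_map_hd_not_in_tl: "p \<in> \<P> \<Longrightarrow> q \<in> \<P> \<Longrightarrow> f_map \<alpha> (hd q) \<notin> set (tl p)"
  by (metis hd_predecessor path_system_hd_not_in_tl system)

lemma distinct_link:
  assumes "p \<in> \<P>" "q \<in> \<P>"
  shows "distinct (link \<alpha> p q)"
proof -
  have "distinct p" "distinct q" using assms path_system_distinct[OF system] by auto
  then show ?thesis
    using f_map_hd_not_in_tl[OF assms]
    by (auto simp: link_def distinct_map inj_on_def distinct_tl)
qed

lemma second_in_tl: "p \<in> \<P> \<Longrightarrow> p ! 1 \<in> set (tl p)"
  using path_system_length[OF system, of p] by (cases p; cases "tl p") auto

lemma set_tl_subset: "set (tl p) \<subseteq> set p"
  by (cases p) auto

lemma path_system_linked: "path_system (linked \<alpha> \<P>)"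
  unfolding path_system_def
proof (intro conjI ballI impI)
  fix r assume "r \<in> linked \<alpha> \<P>"
  then show "distinct r" "2 \<le> length r"
    by (auto elim!: linked_cases simp: distinct_link) (simp add: link_def)
next
  fix r r' assume "r \<in> linked \<alpha> \<P>" "r' \<in> linked \<alpha> \<P>" and meet: "set r \<inter> set r' \<noteq> {}"
  then obtain p q p' q' where
    pq: "p \<in> \<P>" "q \<in> \<P>" "f_map \<alpha> (last q) = last p" "r = link \<alpha> p q" and
    pq': "p' \<in> \<P>" "q' \<in> \<P>" "f_map \<alpha> (last q') = last p'" "r' = link \<alpha> p' q'"
    by (metis linked_cases)
  have same: "p = p'" if "v \<in> set p" "v \<in> set p'" for v
    using path_system_eqI[OF system pq(1) pq'(1)] that .
  have same': "q = q'" if "v \<in> set q" "v \<in> set q'" for v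
    using path_system_eqI[OF system pq(2) pq'(2)] that .
  \<comment> \<open>Suffixes 00 and 01 come from \<open>p\<close> and suffix 11 from
    \<open>q\<close>, except for the end \<open>f_map \<alpha> (hd q)\<close> with suffix 01, which
    no tail contains. So a common vertex forces a common \<open>p\<close> or a common
    \<open>q\<close>.\<close>
  have "p = p' \<or> q = q'"
  proof (rule ccontr)
    assume "\<not> (p = p' \<or> q = q')"
    then have "set p \<inter> set p' = {}" "set q \<inter> set q' = {}"
      using same same' by (meson disjoint_iff)+
    moreover from this have "set (tl p) \<inter> set (tl p') = {}"
      using set_tl_subset by (meson disjoint_iff subsetD)
    moreover have "p ! 1 \<noteq> p' ! 1" "hd q \<noteq> hd q'"
      using calculation second_in_tl[OF pq(1)] second_in_tl[OF pq'(1)] nonempty[OF pq(2)]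
        nonempty[OF pq'(2)] hd_in_set by (metis disjoint_iff)+
    ultimately show False
      using meet f_map_hd_not_in_tl[OF pq(1) pq'(2)] f_map_hd_not_in_tl[OF pq'(1) pq(2)]
      unfolding pq(4) pq'(4) set_link by auto
  qed
  \<comment> \<open>The linking condition at the last vertices determines each of the two paths from
    the other.\<close>
  moreover have "p = p' \<longleftrightarrow> q = q'"
    using pq(3) pq'(3) same[of "last p"] same'[of "last q"]
      nonempty[OF pq(1)] nonempty[OF pq'(1)] nonempty[OF pq(2)] nonempty[OF pq'(2)]
    by (metis f_map_eq last_in_set)
  ultimately show "r = r'" using pq pq' by blast
qed

section \<open>The graph behind the new paths: its edges and vertices\<close>

lemma path_first_eq: "p \<in> \<P> \<Longrightarrow> path_first p = hd p"
  using nonempty by (simp add: path_first_def hd_conv_nth)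

lemma M_FL_eq: "M_FL \<P> = (\<lambda>v. {v @ [False], v @ [True]}) ` (hd ` \<P> \<union> last ` \<P>)"
proof -
  have "path_first ` \<P> = hd ` \<P>" using path_first_eq by simp
  then show ?thesis by (auto simp: M_FL_def path_last_def)
qed

lemma suffix_M_FL_iff: "e \<in> suffix_image [True] ` M_FL \<P> \<longleftrightarrow>
    (\<exists>v \<in> hd ` \<P> \<union> last ` \<P>. e = {v @ [False, True], v @ [True, True]})"
proof -
  have "suffix_image [True] ` M_FL \<P> =
      (\<lambda>v. {v @ [False, True], v @ [True, True]}) ` (hd ` \<P> \<union> last ` \<P>)"
    unfolding M_FL_eq image_image[of "suffix_image [True]"] by simp
  then show ?thesis by (simp only: image_iff)
qed

lemma M_S_iff: "e \<in> M_S \<P> \<longleftrightarrow> (\<exists>p\<in>\<P>. e = {p ! 1 @ [False, False], p ! 1 @ [False, True]})"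
  by (auto simp: M_S_def path_second_def)

text \<open>The right-hand side is the edge set of the graph in \<open>new_paths_of\<close>. Each of
  its edges prescribes \<open>p\<close> or \<open>q\<close>, and the pairing at last vertices
  supplies the other one.\<close>

lemma family_edges_linked:
  "family_edges (linked \<alpha> \<P>) = M_S \<P> \<union> suffix_image [False, True] ` (\<Union>p\<in>\<P>. path_edges (tl p)) \<union>
    suffix_image [True, True] ` (`) (f_map \<alpha>) ` family_edges \<P> \<union>
    suffix_image [True] ` M_FL \<P>" (is "?L = ?A \<union> ?B \<union> ?C \<union> ?D")
proof (intro equalityI subsetI)
  fix e assume "e \<in> ?L"
  then obtain r where "r \<in> linked \<alpha> \<P>" "e \<in> path_edges r"
    unfolding family_edges_iff by (elim bexE)
  then obtain p q where pq: "p \<in> \<P>" "q \<in> \<P>" "f_map \<alpha> (last q) = last p" "e \<in> path_edges (link \<alpha> p q)"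
    by (elim linked_cases) simp
  \<comment> \<open>The end of the link is again a first vertex, so the final edge is a copy of an
    \<open>M_FL\<close> edge.\<close>
  obtain p' where p': "p' \<in> \<P>" "f_map \<alpha> (hd q) = hd p'"
    using hd_predecessor pq(2) by blast
  have "e = {p ! 1 @ [False, False], p ! 1 @ [False, True]} \<or>
      e = {last p @ [False, True], last p @ [True, True]} \<or>
      e = {hd p' @ [False, True], hd p' @ [True, True]} \<or>
      e \<in> suffix_image [False, True] ` path_edges (tl p) \<or>
      e \<in> suffix_image [True, True] ` (`) (f_map \<alpha>) ` path_edges q"
    using pq(4) unfolding path_edges_link[OF path_system_length[OF system pq(1)] nonempty[OF pq(2)] pq(3)] p'(2)
      Un_iff insert_iff empty_iff by meson
  then consider
      "e = {p ! 1 @ [False, False], p ! 1 @ [False, True]}"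
    | "e = {last p @ [False, True], last p @ [True, True]}"
    | "e = {hd p' @ [False, True], hd p' @ [True, True]}"
    | "e \<in> suffix_image [False, True] ` path_edges (tl p)"
    | "e \<in> suffix_image [True, True] ` (`) (f_map \<alpha>) ` path_edges q"
    by meson
  then show "e \<in> ?A \<union> ?B \<union> ?C \<union> ?D"
  proof cases
    case 1
    then have "e \<in> ?A" using pq(1) by (auto simp: M_S_iff)
    then show ?thesis by simp
  next
    case 2
    then have "e \<in> ?D" using pq(1) unfolding suffix_M_FL_iff by blast
    then show ?thesis by simp
  next
    case 3
    then have "e \<in> ?D" using p'(1) unfolding suffix_M_FL_iff by blast
    then show ?thesis by simp
  next
    case 4
    then have "e \<in> ?B" using pq(1) by blast
    then show ?thesis by simp
  next
    case 5
    moreover have "path_edges q \<subseteq> family_edges \<P>" using pq(2) family_edges_iff by blast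
    ultimately have "e \<in> ?C" by blast
    then show ?thesis by simp
  qed
next
  fix e assume e: "e \<in> ?A \<union> ?B \<union> ?C \<union> ?D"
  have link: "e \<in> ?L" if "p \<in> \<P>" "q \<in> \<P>" "f_map \<alpha> (last q) = last p" "e \<in> path_edges (link \<alpha> p q)" for p q
    unfolding family_edges_iff using that by (intro bexI[of _ "link \<alpha> p q"]) (auto simp: linked_def)
  have link_edges: "e \<in> path_edges (link \<alpha> p q) \<longleftrightarrow>
      e = {p ! 1 @ [False, False], p ! 1 @ [False, True]} \<or>
      e = {last p @ [False, True], last p @ [True, True]} \<or>
      e = {f_map \<alpha> (hd q) @ [False, True], f_map \<alpha> (hd q) @ [True, True]} \<or>
      e \<in> suffix_image [False, True] ` path_edges (tl p) \<or>
      e \<in> suffix_image [True, True] ` (`) (f_map \<alpha>) ` path_edges q"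
    if "p \<in> \<P>" "q \<in> \<P>" "f_map \<alpha> (last q) = last p" for p q
    unfolding path_edges_link[OF path_system_length[OF system that(1)] nonempty[OF that(2)] that(3)]
      Un_iff insert_iff empty_iff by meson
  have D: "e \<in> ?D \<longleftrightarrow> (\<exists>p\<in>\<P>. e = {hd p @ [False, True], hd p @ [True, True]}) \<or>
      (\<exists>p\<in>\<P>. e = {last p @ [False, True], last p @ [True, True]})"
    unfolding suffix_M_FL_iff bex_Un by simp
  have B: "e \<in> ?B \<longleftrightarrow> (\<exists>p\<in>\<P>. e \<in> suffix_image [False, True] ` path_edges (tl p))"
    by (simp only: image_UN UN_iff)
  have "family_edges \<P> = (\<Union>p\<in>\<P>. path_edges p)" by (simp add: family_graph_def)
  then have C: "e \<in> ?C \<longleftrightarrow> (\<exists>q\<in>\<P>. e \<in> suffix_image [True, True] ` (`) (f_map \<alpha>) ` path_edges q)"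
    by (simp only: image_UN UN_iff)
  from e consider
      p where "p \<in> \<P>" "e = {p ! 1 @ [False, False], p ! 1 @ [False, True]}"
    | p where "p \<in> \<P>" "e \<in> suffix_image [False, True] ` path_edges (tl p)"
    | q where "q \<in> \<P>" "e \<in> suffix_image [True, True] ` (`) (f_map \<alpha>) ` path_edges q"
    | p where "p \<in> \<P>" "e = {last p @ [False, True], last p @ [True, True]}"
    | p where "p \<in> \<P>" "e = {hd p @ [False, True], hd p @ [True, True]}"
    unfolding Un_iff B C D M_S_iff by meson
  then show "e \<in> ?L"
  proof cases
    case (1 p)
    moreover obtain q where "q \<in> \<P>" "f_map \<alpha> (last q) = last p" using successor 1(1) by blast
    ultimately show ?thesis using link[of p q] link_edges[of p q] by meson
  next
    case (2 p)
    moreover obtain q where "q \<in> \<P>" "f_map \<alpha> (last q) = last p" using successor 2(1) by blast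
    ultimately show ?thesis using link[of p q] link_edges[of p q] by meson
  next
    case (3 q)
    moreover obtain p where "p \<in> \<P>" "f_map \<alpha> (last q) = last p" using predecessor 3(1) by blast
    ultimately show ?thesis using link[of p q] link_edges[of p q] by meson
  next
    case (4 p)
    moreover obtain q where "q \<in> \<P>" "f_map \<alpha> (last q) = last p" using successor 4(1) by blast
    ultimately show ?thesis using link[of p q] link_edges[of p q] by meson
  next
    \<comment> \<open>This edge ends a linked path: pairing first vertices gives \<open>q\<close>,
      and then pairing last vertices gives \<open>p\<close>.\<close>
    case (5 p')
    obtain q where q: "q \<in> \<P>" "f_map \<alpha> (hd q) = hd p'" using hd_successor 5(1) by blast
    obtain p where "p \<in> \<P>" "f_map \<alpha> (last q) = last p" using predecessor q(1) by blast
    then show ?thesis using link[of p q] link_edges[of p q] q 5(2) by metis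
  qed
qed

lemma path_edges_eq_tl:
  assumes "p \<in> \<P>"
  shows "path_edges p = insert {hd p, p ! 1} (path_edges (tl p))"
proof -
  obtain x y zs where "p = x # y # zs"
    using path_system_length[OF system assms] by (cases p; cases "tl p") auto
  then show ?thesis by simp
qed

lemma edges_factor_of:
  "edges (factor_of \<alpha> \<P>) = suffix_image [False] ` family_edges \<P> \<union>
    suffix_image [True] ` (`) (f_map \<alpha>) ` family_edges \<P> \<union> M_FL \<P>"
  unfolding factor_of_def graph_union_def edge_graph_def ugraph.select_convs family_edges_append family_edges_map Un_assoc
  by (rule refl)

text \<open>Deleting the first edges turns the paths with suffix 0 into their tails and removes
  nothing else.\<close>

lemma edges_factor_minus_of:
  "edges (factor_minus_of \<alpha> \<P>) = suffix_image [False] ` (\<Union>p\<in>\<P>. path_edges (tl p)) \<union>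
    suffix_image [True] ` (`) (f_map \<alpha>) ` family_edges \<P> \<union> M_FL \<P>"
proof -
  let ?D = "{{path_first p @ [False], path_second p @ [False]} |p. p \<in> \<P>}"
  let ?T = "\<Union>p\<in>\<P>. path_edges (tl p)"
  have D: "?D = suffix_image [False] ` (\<lambda>p. {hd p, p ! 1}) ` \<P>"
    using path_first_eq by (auto simp: path_second_def image_image setcompr_eq_image)
  have E: "family_edges \<P> = (\<lambda>p. {hd p, p ! 1}) ` \<P> \<union> ?T"
    using path_edges_eq_tl by (auto simp: family_graph_def)
  have "{hd p, p ! 1} \<notin> path_edges (tl q)" if "p \<in> \<P>" "q \<in> \<P>" for p q
    using path_edges_subset path_system_hd_not_in_tl[OF system that] by fastforce
  then have "(\<lambda>p. {hd p, p ! 1}) ` \<P> \<inter> ?T = {}" by blast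
  then have diff: "family_edges \<P> - (\<lambda>p. {hd p, p ! 1}) ` \<P> = ?T" unfolding E by blast
  have inj: "inj (suffix_image [False])"
    by (rule inj_on_image) (simp add: inj_on_def)
  have *: "suffix_image [False] ` family_edges \<P> - ?D = suffix_image [False] ` ?T"
    unfolding D diff[symmetric] by (rule image_set_diff[OF inj, symmetric])
  \<comment> \<open>Deleted edges have both ends in suffix 0, whereas every edge of the other two
    kinds has an end in suffix 1.\<close>
  have no_one: "\<not> (\<exists>v\<in>e. last v)" if "e \<in> ?D" for e
    using that by auto
  have "\<exists>v\<in>e. last v" if "e \<in> suffix_image [True] ` (`) (f_map \<alpha>) ` family_edges \<P>" for e
    using that family_edges_nonempty by force
  then have **: "suffix_image [True] ` (`) (f_map \<alpha>) ` family_edges \<P> \<inter> ?D = {}"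
    using no_one by (meson disjoint_iff)
  have "\<exists>v\<in>e. last v" if "e \<in> M_FL \<P>" for e
    using that by (auto simp: M_FL_eq)
  then have ***: "M_FL \<P> \<inter> ?D = {}"
    using no_one by (meson disjoint_iff)
  show ?thesis
    unfolding factor_minus_of_def delete_edges_def edges_factor_of ugraph.select_convs Un_Diff *
      Diff_triv[OF **] Diff_triv[OF ***] by (rule refl)
qed

text \<open>The matching \<open>M_FL\<close> adds no vertices: its ends lie on the copy with suffix
  0 as path ends, and on the copy with suffix 1 by invariance.\<close>

lemma verts_factor_minus_of:
  "verts (factor_minus_of \<alpha> \<P>) = suffix_image [False] (\<Union>(set ` \<P>)) \<union>
    suffix_image [True] (f_map \<alpha> ` \<Union>(set ` \<P>))"
proof -
  let ?E = "hd ` \<P> \<union> last ` \<P>"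
  have E: "?E \<subseteq> \<Union>(set ` \<P>)"
    using nonempty by force
  then have "f_map \<alpha> ` ?E \<subseteq> f_map \<alpha> ` \<Union>(set ` \<P>)" by (rule image_mono)
  then have E': "?E \<subseteq> f_map \<alpha> ` \<Union>(set ` \<P>)"
    by (simp only: image_Un hd_invariant last_invariant)
  have "\<Union>(M_FL \<P>) = suffix_image [False] ?E \<union> suffix_image [True] ?E"
    unfolding M_FL_eq by blast
  moreover have "verts (factor_minus_of \<alpha> \<P>) = suffix_image [False] (\<Union>(set ` \<P>)) \<union>
    suffix_image [True] (f_map \<alpha> ` \<Union>(set ` \<P>)) \<union> \<Union>(M_FL \<P>)"
    by (simp add: factor_minus_of_def delete_edges_def factor_of_def graph_union_def edge_graph_def
        family_graph_def append_family_def image_UN Un_assoc)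
  moreover have "A \<union> B \<union> (C \<union> D) = A \<union> B" if "C \<subseteq> A" "D \<subseteq> B" for A B C D :: "bits set"
    using that by blast
  ultimately show ?thesis
    using image_mono[OF E, of "\<lambda>v. v @ [False]"] image_mono[OF E', of "\<lambda>v. v @ [True]"] by presburger
qed

lemma set_eq_insert_hd: "p \<in> \<P> \<Longrightarrow> set p = insert (hd p) (set (tl p))"
  using nonempty by (cases p) auto

text \<open>First vertices with suffix 01 are missing from the tails; they return as the final
  vertices of linked paths.\<close>

lemma verts_linked:
  "verts (family_graph (linked \<alpha> \<P>)) = suffix_image [False, False] ((\<lambda>p. p ! 1) ` \<P>) \<union>
    suffix_image [False, True] (\<Union>(set ` \<P>)) \<union> suffix_image [True, True] (f_map \<alpha> ` \<Union>(set ` \<P>))"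
  (is "?L = ?A \<union> ?B \<union> ?C")
proof (intro equalityI subsetI)
  fix v assume "v \<in> ?L"
  then obtain p q where pq: "p \<in> \<P>" "q \<in> \<P>" "v \<in> set (link \<alpha> p q)"
    by (auto simp: family_graph_def linked_def)
  obtain p' where p': "p' \<in> \<P>" "f_map \<alpha> (hd q) = hd p'"
    using hd_predecessor pq(2) by blast
  then have "f_map \<alpha> (hd q) \<in> \<Union>(set ` \<P>)" using nonempty by force
  moreover have "set (tl p) \<subseteq> \<Union>(set ` \<P>)"
    using set_tl_subset pq(1) by (meson UN_upper order_trans)
  ultimately have tl: "insert (f_map \<alpha> (hd q)) (set (tl p)) \<subseteq> \<Union>(set ` \<P>)" by simp
  from pq(3) consider "v = p ! 1 @ [False, False]"
    | "v \<in> suffix_image [False, True] (insert (f_map \<alpha> (hd q)) (set (tl p)))"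
    | "v \<in> suffix_image [True, True] (f_map \<alpha> ` set q)"
    unfolding set_link Un_iff insert_iff by meson
  then show "v \<in> ?A \<union> ?B \<union> ?C"
  proof cases
    case 1
    then have "v \<in> ?A" using pq(1) by simp
    then show ?thesis by simp
  next
    case 2
    then have "v \<in> ?B" using image_mono[OF tl] by (rule subsetD[rotated])
    then show ?thesis by simp
  next
    case 3
    then have "v \<in> ?C" using pq(2) by blast
    then show ?thesis by simp
  qed
next
  fix v assume v: "v \<in> ?A \<union> ?B \<union> ?C"
  have link: "v \<in> ?L" if "p \<in> \<P>" "q \<in> \<P>" "f_map \<alpha> (last q) = last p" "v \<in> set (link \<alpha> p q)" for p q
    using that unfolding family_graph_def linked_def by auto
  have B: "v \<in> ?B \<longleftrightarrow> (\<exists>p\<in>\<P>. v = hd p @ [False, True] \<or> v \<in> suffix_image [False, True] (set (tl p)))"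
    using set_eq_insert_hd by (simp only: image_UN UN_iff image_insert insert_iff cong: bex_cong)
  have C: "v \<in> ?C \<longleftrightarrow> (\<exists>q\<in>\<P>. v \<in> suffix_image [True, True] (f_map \<alpha> ` set q))"
    by (simp only: image_UN UN_iff)
  have A: "v \<in> ?A \<longleftrightarrow> (\<exists>p\<in>\<P>. v = p ! 1 @ [False, False])"
    by (auto simp: image_iff)
  from v consider
      p where "p \<in> \<P>" "v = p ! 1 @ [False, False] \<or> v \<in> suffix_image [False, True] (set (tl p))"
    | p where "p \<in> \<P>" "v = hd p @ [False, True]"
    | q where "q \<in> \<P>" "v \<in> suffix_image [True, True] (f_map \<alpha> ` set q)"
    unfolding Un_iff A B C by meson
  then show "v \<in> ?L"
  proof cases
    case (1 p)
    moreover obtain q where "q \<in> \<P>" "f_map \<alpha> (last q) = last p" using successor 1(1) by blast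
    ultimately show ?thesis using link[of p q] unfolding set_link by blast
  next
    case (2 p')
    obtain q where q: "q \<in> \<P>" "f_map \<alpha> (hd q) = hd p'" using hd_successor 2(1) by blast
    moreover obtain p where "p \<in> \<P>" "f_map \<alpha> (last q) = last p" using predecessor q(1) by blast
    ultimately show ?thesis using link[of p q] 2(2) unfolding set_link by auto
  next
    case (3 q)
    moreover obtain p where "p \<in> \<P>" "f_map \<alpha> (last q) = last p" using predecessor 3(1) by blast
    ultimately show ?thesis using link[of p q] unfolding set_link by blast
  qed
qed

text \<open>Since the graph of the construction is the union of the disjoint linked paths, its
  components can be read off.\<close>

lemma linking_graph_eq:
  "graph_union (edge_graph (M_S \<P>)) (append_graph (factor_minus_of \<alpha> \<P>) [True]) =
    family_graph (linked \<alpha> \<P>)" (is "?G = ?H")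
proof -
  have "edges ?G = edges ?H"
    unfolding graph_union_def edge_graph_def append_graph_def map_graph_def
      edges_factor_minus_of family_edges_linked
    by (simp add: image_Un image_image Un_assoc)
  moreover have "verts ?G = verts ?H"
  proof -
    have "\<Union>(M_S \<P>) = suffix_image [False, False] ((\<lambda>p. p ! 1) ` \<P>) \<union>
        suffix_image [False, True] ((\<lambda>p. p ! 1) ` \<P>)"
      by (auto simp: M_S_def path_second_def)
    moreover have "(\<lambda>p. p ! 1) ` \<P> \<subseteq> \<Union>(set ` \<P>)"
      using second_in_tl set_tl_subset by (meson UN_I image_subsetI subsetD)
    ultimately show ?thesis
      unfolding graph_union_def edge_graph_def append_graph_def map_graph_def verts_linked
      by (auto simp: verts_factor_minus_of image_Un image_image)
  qed
  ultimately show ?thesis by simp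
qed

lemma new_paths_of_eq: "new_paths_of \<alpha> \<P> = linked \<alpha> \<P>"
proof (intro equalityI subsetI)
  fix r assume r: "r \<in> linked \<alpha> \<P>"
  then obtain p q where pq: "p \<in> \<P>" "r = link \<alpha> p q" by (metis linked_cases)
  have "path_first r = p ! 1 @ [False, False]"
    using pq by (simp add: link_def path_first_def)
  moreover have "path_second r = p ! 1 @ [False, True]"
    using pq(2) path_system_length[OF system pq(1)]
    by (cases p; cases "tl p") (auto simp: link_def path_second_def)
  ultimately show "r \<in> new_paths_of \<alpha> \<P>"
    unfolding new_paths_of_def linking_graph_eq components_family_graph[OF path_system_linked]
    using r pq(1) path_system_distinct[OF path_system_linked r]
      path_system_length[OF path_system_linked r] by (auto simp: path_second_def)
next
  fix r assume "r \<in> new_paths_of \<alpha> \<P>"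
  then obtain r' p where r: "distinct r" "2 \<le> length r" "r' \<in> linked \<alpha> \<P>" "path_graph r = path_graph r'"
    "p \<in> \<P>" "path_first r = p ! 1 @ [False, False]"
    unfolding new_paths_of_def linking_graph_eq components_family_graph[OF path_system_linked]
    by (auto simp: path_second_def)
  obtain p' q' where r': "r' = link \<alpha> p' q'" using linked_cases[OF r(3)] by metis
  have "set r = set r'" using arg_cong[OF r(4), of verts] by simp
  moreover have "path_first r \<in> set r" using r(2) by (cases r) (auto simp: path_first_def)
  ultimately have "p ! 1 @ [False, False] \<in> set r'" using r(6) by simp
  \<comment> \<open>The start is the only vertex of a linked path with suffix 00, so both lists
    begin alike and have the same orientation.\<close>
  then have "p ! 1 = p' ! 1" unfolding r' set_link by auto
  then have "r ! 0 = r' ! 0" using r(6) r' by (simp add: path_first_def link_def)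
  then have "r = r'"
    using path_graph_eq_imp_eq[OF r(4) r(1)] path_system_distinct[OF path_system_linked r(3)] by blast
  then show "r \<in> linked \<alpha> \<P>" using r(3) by simp
qed

end

section \<open>The families of paths\<close>

text \<open>The two heights are those of layers \<open>k\<close> and \<open>k + 1\<close>. Excluding
  positive words of the lower layer keeps the starts s00 of linked paths off the family that is
  copied with suffix 00.\<close>

definition in_layer :: "nat \<Rightarrow> nat \<Rightarrow> bits \<Rightarrow> bool" where
  "in_layer n k v \<longleftrightarrow> length v = 2 * n \<and>
    (height v = 2 * (int k - int n) \<and> \<not> positive v \<or> height v = 2 * (int k + 1 - int n))"

text \<open>The induction invariant for \<open>path_family\<close>; it fixes all first, second and
  last vertices independently of the parameters.\<close>

definition layer_family :: "nat \<Rightarrow> nat \<Rightarrow> bits path set \<Rightarrow> bool" where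
  "layer_family n k \<P> \<longleftrightarrow> path_system \<P> \<and> hd ` \<P> = first_set n k \<and>
    (\<lambda>p. p ! 1) ` \<P> = second_set n k \<and> last ` \<P> = last_set n k \<and>
    (\<forall>p\<in>\<P>. \<forall>v\<in>set p. in_layer n k v)"

lemma path_family_eq_empty: "2 * n \<le> k \<Longrightarrow> path_family \<alpha> n k = {}"
  by (cases "(\<alpha>, n, k)" rule: path_family.cases) auto

lemma path_family_middle_step:
  "1 \<le> n \<Longrightarrow> path_family \<alpha> (Suc n) (Suc n) =
    append_family (path_family \<alpha> n (Suc n)) [False, False] \<union>
    append_family (path_family \<alpha> n n) [True, False] \<union> new_paths_of (\<alpha> (2 * n)) (path_family \<alpha> n n)"
  by (cases n) auto

text \<open>For \<open>j >= 2 * n\<close> all the families involved are empty, so the recursion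
  extends to every \<open>j >= n\<close>.\<close>

lemma path_family_upper_step:
  assumes "1 \<le> n" "n \<le> j"
  shows "path_family \<alpha> (Suc n) (Suc (Suc j)) =
    append_family (path_family \<alpha> n (Suc (Suc j))) [False, False] \<union>
    append_family (path_family \<alpha> n (Suc j)) [True, False] \<union>
    append_family (path_family \<alpha> n (Suc j)) [False, True] \<union>
    append_family (path_family \<alpha> n j) [True, True]"
proof (cases "j < 2 * n")
  case True
  then show ?thesis using assms by (cases n) (auto simp: Let_def)
next
  case False
  then have "path_family \<alpha> (Suc n) (Suc (Suc j)) = {}" "path_family \<alpha> n (Suc (Suc j)) = {}"
    "path_family \<alpha> n (Suc j) = {}" "path_family \<alpha> n j = {}"
    by (simp_all add: path_family_eq_empty del: path_family.simps)
  then show ?thesis by (simp add: append_family_def)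
qed

text \<open>The parameter with index \<open>2 * n\<close> first acts in the passage from
  \<open>n\<close> to \<open>n + 1\<close>, whence the strict bound on \<open>i\<close>.\<close>

lemma path_family_cong:
  assumes "\<forall>i\<in>{1..<n}. \<alpha> (2 * i) = \<alpha>' (2 * i)"
  shows "path_family \<alpha> n k = path_family \<alpha>' n k"
  using assms
proof (induction n arbitrary: k)
  case (Suc n)
  show ?case
  proof (cases n)
    case (Suc m)
    have IH: "path_family \<alpha> n j = path_family \<alpha>' n j" for j
      using Suc.IH Suc.prems by simp
    have "\<alpha> (2 * n) = \<alpha>' (2 * n)" using Suc.prems Suc by (intro bspec[OF Suc.prems]) simp
    then show ?thesis using IH unfolding Suc path_family.simps Let_def by presburger
  qed simp
qed simp

section \<open>First, second and last vertices under appending and linking\<close>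

lemma append_family_images:
  assumes "path_system \<P>"
  shows "hd ` append_family \<P> y = suffix_image y (hd ` \<P>)"
    and "(\<lambda>p. p ! 1) ` append_family \<P> y = suffix_image y ((\<lambda>p. p ! 1) ` \<P>)"
    and "last ` append_family \<P> y = suffix_image y (last ` \<P>)"
proof -
  have "p \<noteq> []" "1 < length p" if "p \<in> \<P>" for p
    using path_system_length[OF assms that] by auto
  then show "hd ` append_family \<P> y = suffix_image y (hd ` \<P>)"
    "(\<lambda>p. p ! 1) ` append_family \<P> y = suffix_image y ((\<lambda>p. p ! 1) ` \<P>)"
    "last ` append_family \<P> y = suffix_image y (last ` \<P>)"
    by (auto simp: append_family_def image_image hd_map last_map intro!: image_cong)
qed

lemma append_family_vertex:
  "p \<in> append_family \<P> y \<Longrightarrow> v \<in> set p \<Longrightarrow> \<exists>q\<in>\<P>. \<exists>u\<in>set q. v = u @ y"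
  unfolding append_family_def by (elim imageE) auto

lemma append_family_disjoint:
  assumes "p \<in> append_family \<P> y" "q \<in> append_family \<Q> z" "y \<noteq> z" "length y = length z"
  shows "set p \<inter> set q = {}"
  using assms append_family_vertex[of p \<P> y] append_family_vertex[of q \<Q> z]
  by (metis append_eq_append_conv disjoint_iff)

lemma in_layer_snoc2:
  assumes "in_layer n k v"
  shows "in_layer (Suc n) k (v @ [False, False])"
    and "in_layer (Suc n) (Suc k) (v @ [True, False])"
    and "in_layer (Suc n) (Suc k) (v @ [False, True])"
    and "in_layer (Suc n) (Suc (Suc k)) (v @ [True, True])"
  using assms positive_snoc2[of v n] by (auto simp: in_layer_def)

context compatible_system
begin

lemma link_images:
  assumes "p \<in> \<P>"
  shows "hd (link \<alpha> p q) = p ! 1 @ [False, False]"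
    and "link \<alpha> p q ! 1 = p ! 1 @ [False, True]"
    and "last (link \<alpha> p q) = f_map \<alpha> (hd q) @ [False, True]"
proof -
  show "link \<alpha> p q ! 1 = p ! 1 @ [False, True]"
    using path_system_length[OF system assms] by (cases p; cases "tl p") (auto simp: link_def)
qed (auto simp: link_def)

text \<open>In the linked pairs both \<open>p\<close> and \<open>q\<close> range over the whole
  family, and invariance replaces the vertices \<open>f_map \<alpha> (hd q)\<close> by the first
  vertices themselves.\<close>

lemma linked_images:
  shows "hd ` linked \<alpha> \<P> = suffix_image [False, False] ((\<lambda>p. p ! 1) ` \<P>)" (is ?first)
    and "(\<lambda>p. p ! 1) ` linked \<alpha> \<P> = suffix_image [False, True] ((\<lambda>p. p ! 1) ` \<P>)" (is ?second)
    and "last ` linked \<alpha> \<P> = suffix_image [False, True] (hd ` \<P>)" (is ?third)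
proof -
  let ?R = "{(p, q). p \<in> \<P> \<and> q \<in> \<P> \<and> f_map \<alpha> (last q) = last p}"
  have L: "linked \<alpha> \<P> = (\<lambda>(p, q). link \<alpha> p q) ` ?R"
    by (auto simp: linked_def)
  have fst: "fst ` ?R = \<P>"
  proof (intro equalityI subsetI)
    fix p assume p: "p \<in> \<P>"
    then obtain q where "q \<in> \<P>" "f_map \<alpha> (last q) = last p" using successor by meson
    then show "p \<in> fst ` ?R" using p by (intro image_eqI[of _ _ "(p, q)"]) auto
  qed auto
  have snd: "snd ` ?R = \<P>"
  proof (intro equalityI subsetI)
    fix q assume q: "q \<in> \<P>"
    then obtain p where "p \<in> \<P>" "f_map \<alpha> (last q) = last p" using predecessor by meson
    then show "q \<in> snd ` ?R" using q by (intro image_eqI[of _ _ "(p, q)"]) auto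
  qed auto
  have "hd ` linked \<alpha> \<P> = (\<lambda>pq. fst pq ! 1 @ [False, False]) ` ?R"
    "(\<lambda>p. p ! 1) ` linked \<alpha> \<P> = (\<lambda>pq. fst pq ! 1 @ [False, True]) ` ?R"
    "last ` linked \<alpha> \<P> = (\<lambda>pq. f_map \<alpha> (hd (snd pq)) @ [False, True]) ` ?R"
    unfolding L image_image by (intro image_cong refl; auto simp: link_images simp del: One_nat_def)+
  moreover have "(\<lambda>pq. g (fst pq)) ` ?R = g ` \<P>" "(\<lambda>pq. g (snd pq)) ` ?R = g ` \<P>"
    for g :: "bits path \<Rightarrow> bits"
    using fst snd by (metis image_image)+
  moreover have "suffix_image [False, True] (hd ` \<P>) = (\<lambda>q. f_map \<alpha> (hd q) @ [False, True]) ` \<P>"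
    by (subst hd_invariant[symmetric]) (simp only: image_image)
  ultimately show ?first ?second ?third
    by (simp_all only: image_image)
qed

end

lemma compatible_system_layer_family:
  assumes "1 \<le> n" "layer_family n n \<P>"
  shows "compatible_system \<alpha> \<P>"
  using assms f_map_first_set[of n \<alpha>] f_map_last_set[of \<alpha> n]
  by unfold_locales (auto simp: layer_family_def)

text \<open>The second claim serves to keep linked paths disjoint from the copies with suffixes 00
  and 10.\<close>

lemma layer_family_linked_vertices:
  assumes "1 \<le> n" "layer_family n n \<P>" "r \<in> linked \<alpha> \<P>" "v \<in> set r"
  shows "in_layer (Suc n) (Suc n) v"
    and "(\<exists>s \<in> second_set n n. v = s @ [False, False]) \<or> (\<exists>u a. v = u @ [a, True])"
proof -
  interpret compatible_system \<alpha> \<P>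
    using compatible_system_layer_family assms by blast
  obtain p q where pq: "p \<in> \<P>" "q \<in> \<P>" "f_map \<alpha> (last q) = last p" "r = link \<alpha> p q"
    using linked_cases[OF assms(3)] .
  have layer: "in_layer n n u" if "u \<in> set p \<or> u \<in> set q" for u
    using that pq assms(2) by (auto simp: layer_family_def)
  have sec: "p ! 1 \<in> second_set n n"
    using pq assms(2) by (auto simp: layer_family_def)
  obtain q' where "q' \<in> \<P>" "f_map \<alpha> (hd q) = hd q'" using hd_predecessor[OF pq(2)] by meson
  then have hd: "in_layer n n (f_map \<alpha> (hd q))"
    using nonempty assms(2) by (simp add: layer_family_def)
  \<comment> \<open>Heights 0 and 2 become 0 and -2 under \<open>f_map\<close>, and 2 and 0 after
    the suffix 11; a word of height 0 is not positive.\<close>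
  have f: "in_layer (Suc n) (Suc n) (f_map \<alpha> u @ [True, True])" if "u \<in> set q" for u
    using layer[of u] that positive_imp_height[of "f_map \<alpha> u @ [True, True]" "Suc n"]
    by (auto simp: in_layer_def)
  consider "v = p ! 1 @ [False, False]" | "v = f_map \<alpha> (hd q) @ [False, True]"
    | u where "u \<in> set p" "v = u @ [False, True]" | u where "u \<in> set q" "v = f_map \<alpha> u @ [True, True]"
    using assms(4) subsetD[OF set_tl_subset, of _ p] unfolding pq(4) set_link by auto
  then have "in_layer (Suc n) (Suc n) v \<and>
      ((\<exists>s \<in> second_set n n. v = s @ [False, False]) \<or> (\<exists>u a. v = u @ [a, True]))"
  proof cases
    case 1
    moreover have "in_layer (Suc n) (Suc n) v"
      using 1 sec positive_imp_height[of v "Suc n"] by (auto simp: in_layer_def second_set_def)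
    ultimately show ?thesis using sec by blast
  next
    case 2
    then show ?thesis using in_layer_snoc2(3)[OF hd] by blast
  next
    case (3 u)
    then show ?thesis using in_layer_snoc2(3)[OF layer] by blast
  next
    case (4 u)
    then show ?thesis using f by blast
  qed
  then show "in_layer (Suc n) (Suc n) v"
    "(\<exists>s \<in> second_set n n. v = s @ [False, False]) \<or> (\<exists>u a. v = u @ [a, True])" by auto
qed

section \<open>The invariant for all families, layer by layer\<close>

lemma layer_family_upper_step:
  assumes "n \<le> j" "layer_family n (Suc (Suc j)) \<P>" "layer_family n (Suc j) \<Q>" "layer_family n j \<R>"
  shows "layer_family (Suc n) (Suc (Suc j))
    (append_family \<P> [False, False] \<union> append_family \<Q> [True, False] \<union>
     append_family \<Q> [False, True] \<union> append_family \<R> [True, True])" (is "layer_family _ _ ?U")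
proof -
  have sys: "path_system \<P>" "path_system \<Q>" "path_system \<R>"
    using assms by (auto simp: layer_family_def)
  note images = append_family_images[OF sys(1)] append_family_images[OF sys(2)] append_family_images[OF sys(3)]
  have "path_system ?U"
    by (intro path_system_Un path_system_append_family sys) (auto dest: append_family_disjoint)
  moreover have "hd ` ?U = first_set (Suc n) (Suc (Suc j))"
    "(\<lambda>p. p ! 1) ` ?U = second_set (Suc n) (Suc (Suc j))"
    "last ` ?U = last_set (Suc n) (Suc (Suc j))"
    using assms(2-4) unfolding image_Un images first_set_upper_step[OF assms(1)]
      second_set_upper_step[OF assms(1)] last_set_upper_step[OF assms(1)] layer_family_def by simp_all
  moreover have "in_layer (Suc n) (Suc (Suc j)) v" if p: "p \<in> ?U" "v \<in> set p" for p v
  proof -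
    have *: "\<forall>p\<in>\<P>. \<forall>v\<in>set p. in_layer n (Suc (Suc j)) v" "\<forall>p\<in>\<Q>. \<forall>v\<in>set p. in_layer n (Suc j) v"
      "\<forall>p\<in>\<R>. \<forall>v\<in>set p. in_layer n j v"
      using assms by (auto simp: layer_family_def)
    from p show ?thesis
      using * append_family_vertex[OF _ p(2)] in_layer_snoc2 by (metis UnE)
  qed
  ultimately show ?thesis by (auto simp: layer_family_def)
qed

text \<open>A clash is conceivable only at suffix 00, between a copy of a path of
  \<open>\<P>\<close> and the start of a linked path. That start extends a positive word of height
  2, and such words are excluded by \<open>in_layer\<close>.\<close>

lemma layer_family_middle_step:
  assumes "1 \<le> n" "layer_family n (Suc n) \<P>" "layer_family n n \<Q>"
  shows "layer_family (Suc n) (Suc n)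
    (append_family \<P> [False, False] \<union> append_family \<Q> [True, False] \<union> linked \<alpha> \<Q>)"
    (is "layer_family _ _ ?U")
proof -
  interpret compatible_system \<alpha> \<Q>
    using compatible_system_layer_family assms by blast
  have sys: "path_system \<P>" "path_system \<Q>"
    using assms by (auto simp: layer_family_def)
  note images = append_family_images[OF sys(1)] append_family_images[OF sys(2)] linked_images
  have not_second: "u \<notin> second_set n n" if "p \<in> \<P>" "u \<in> set p" for p u
  proof -
    have "in_layer n (Suc n) u" using that assms(2) by (auto simp: layer_family_def)
    then show ?thesis by (auto simp: in_layer_def second_set_def)
  qed
  have "set p \<inter> set r = {}"
    if p: "p \<in> append_family \<P> [False, False] \<union> append_family \<Q> [True, False]" and r: "r \<in> linked \<alpha> \<Q>" for p r
  proof (rule ccontr)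
    assume "set p \<inter> set r \<noteq> {}"
    then obtain v where v: "v \<in> set p" "v \<in> set r" by blast
    then have "(\<exists>p\<in>\<P>. \<exists>u\<in>set p. v = u @ [False, False]) \<or> (\<exists>u. v = u @ [True, False])"
      using p append_family_vertex[OF _ v(1)] by blast
    then show False
      using layer_family_linked_vertices(2)[OF assms(1,3) r v(2)] not_second by auto
  qed
  moreover have "path_system (append_family \<P> [False, False] \<union> append_family \<Q> [True, False])"
    by (intro path_system_Un path_system_append_family sys) (auto dest: append_family_disjoint)
  ultimately have "path_system ?U"
    using path_system_linked path_system_Un by blast
  moreover have "hd ` ?U = first_set (Suc n) (Suc n)" "(\<lambda>p. p ! 1) ` ?U = second_set (Suc n) (Suc n)"
    "last ` ?U = last_set (Suc n) (Suc n)"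
    using assms(2,3) unfolding image_Un images first_set_step[OF assms(1)]
      second_set_step[OF assms(1)] last_set_step[OF assms(1)] layer_family_def by simp_all
  moreover have "in_layer (Suc n) (Suc n) v" if p: "p \<in> ?U" "v \<in> set p" for p v
  proof (cases "p \<in> linked \<alpha> \<Q>")
    case True
    then show ?thesis using layer_family_linked_vertices(1)[OF assms(1,3)] p by blast
  next
    case False
    have *: "\<forall>p\<in>\<P>. \<forall>v\<in>set p. in_layer n (Suc n) v" "\<forall>p\<in>\<Q>. \<forall>v\<in>set p. in_layer n n v"
      using assms by (auto simp: layer_family_def)
    from False p show ?thesis
      using * append_family_vertex[OF _ p(2)] in_layer_snoc2 by (metis UnE)
  qed
  ultimately show ?thesis by (auto simp: layer_family_def)
qed

lemma layer_family_path_family: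
  assumes "1 \<le> n" "n \<le> k"
  shows "layer_family n k (path_family \<alpha> n k)"
  using assms
proof (induction n arbitrary: k rule: nat_induct_at_least)
  case base
  have "in_layer 1 1 v" if "v \<in> {[True, False], [True, True], [False, True]}" for v
    using that positive_imp_height[of v 1] by (auto simp: in_layer_def)
  then show ?case
    using base first_set_1[of k] second_set_1[of k] last_set_1[of k]
    by (auto simp: layer_family_def path_system_def)
next
  case (Suc n)
  show ?case
  proof (cases "k = Suc n")
    case True
    have fam: "layer_family n n (path_family \<alpha> n n)" "layer_family n (Suc n) (path_family \<alpha> n (Suc n))"
      using Suc by auto
    then show ?thesis
      using layer_family_middle_step[OF Suc.hyps] path_family_middle_step[OF Suc.hyps]
        compatible_system.new_paths_of_eq[OF compatible_system_layer_family[OF Suc.hyps]] True by simp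
  next
    case False
    then obtain j where j: "k = Suc (Suc j)" "n \<le> j"
      using Suc.prems by (metis Suc_le_D Suc_le_mono le_neq_implies_less less_eq_Suc_le)
    then show ?thesis
      using layer_family_upper_step path_family_upper_step[OF Suc.hyps] Suc.IH by simp
  qed
qed

lemma compatible_system_path_family: "1 \<le> n \<Longrightarrow> compatible_system \<beta> (path_family \<alpha> n n)"
  using compatible_system_layer_family layer_family_path_family by blast

section \<open>Recovering the parameters\<close>

lemma suffix_image_inject: "suffix_image y e = suffix_image y e' \<longleftrightarrow> e = e'"
  by (rule inj_image_eq_iff) (simp add: inj_def)

lemma suffix_image_mem_iff: "suffix_image y e \<in> suffix_image y ` X \<longleftrightarrow> e \<in> X"
  by (rule inj_image_mem_iff) (simp add: inj_def suffix_image_inject)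

lemma suffix_image_not_mem:
  assumes "y \<noteq> z" "length y = length z" "\<And>e. e \<in> X \<Longrightarrow> e \<noteq> {}"
  shows "suffix_image y e \<notin> suffix_image z ` X"
proof
  assume "suffix_image y e \<in> suffix_image z ` X"
  then obtain e' where e': "e' \<in> X" "suffix_image y e = suffix_image z e'" by (elim imageE)
  obtain u where "u \<in> e'" using assms(3)[OF e'(1)] by blast
  then have "u @ z \<in> suffix_image y e" using e'(2) by blast
  then show False using assms(1,2) by auto
qed

lemma family_edges_image_nonempty: "e \<in> (`) g ` family_edges \<P> \<Longrightarrow> e \<noteq> {}"
  by (elim imageE) (simp add: family_edges_nonempty)

text \<open>The third alternative covers all remaining edges: the copy with suffix 00, the
  \<open>M_S\<close> edges, the tails with suffix 01 and the matching between 01 and 11. Its two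
  clauses exclude edges inside suffix 11 and edges with an end in suffix 10.\<close>

lemma family_edges_middle_step:
  assumes "1 \<le> n" and e: "e \<in> family_edges (path_family \<alpha> (Suc n) (Suc n))"
  defines "E \<equiv> family_edges (path_family \<alpha> n n)"
  shows "e \<in> suffix_image [True, False] ` E \<or>
    e \<in> suffix_image [True, True] ` (`) (f_map (\<alpha> (2 * n))) ` E \<or>
    (\<exists>u b. u @ [False, b] \<in> e) \<and> (\<forall>u. u @ [True, False] \<notin> e)"
    (is "?A \<or> ?B \<or> ?C")
proof -
  let ?P = "path_family \<alpha> n n"
  interpret compatible_system "\<alpha> (2 * n)" ?P
    using compatible_system_path_family[OF assms(1)] .
  have suffix: ?C if "e' \<noteq> {}" "e = suffix_image [False, b] e'" for e' b
  proof -
    obtain u where "u \<in> e'" using \<open>e' \<noteq> {}\<close> by blast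
    then have "u @ [False, b] \<in> e" using that(2) by blast
    then show ?C using that(2) by auto
  qed
  have "e \<in> suffix_image [False, False] ` family_edges (path_family \<alpha> n (Suc n)) \<or> ?A \<or>
      e \<in> M_S ?P \<or> e \<in> suffix_image [False, True] ` (\<Union>p\<in>?P. path_edges (tl p)) \<or> ?B \<or>
      e \<in> suffix_image [True] ` M_FL ?P"
    using e unfolding path_family_middle_step[OF assms(1)] family_edges_Un family_edges_append
      new_paths_of_eq family_edges_linked E_def Un_iff by meson
  then consider "e \<in> suffix_image [False, False] ` family_edges (path_family \<alpha> n (Suc n))" | ?A
    | "e \<in> M_S ?P" | "e \<in> suffix_image [False, True] ` (\<Union>p\<in>?P. path_edges (tl p))" | ?B
    | "e \<in> suffix_image [True] ` M_FL ?P" by meson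
  then show ?thesis
  proof cases
    case 1
    then obtain e' where e': "e' \<in> family_edges (path_family \<alpha> n (Suc n))" "e = suffix_image [False, False] e'"
      by (elim imageE)
    have ?C by (rule suffix[OF family_edges_nonempty[OF e'(1)] e'(2)])
    then show ?thesis by simp
  next
    case 3
    then show ?thesis by (auto simp: M_S_def)
  next
    case 4
    then obtain e' p where e': "e' \<in> path_edges (tl p)" "e = suffix_image [False, True] e'"
      by (elim imageE UN_E)
    have ?C by (rule suffix[OF path_edges_nonempty[OF e'(1)] e'(2)])
    then show ?thesis by simp
  next
    case 6
    then obtain v where "e = {v @ [False, True], v @ [True, True]}"
      unfolding suffix_M_FL_iff by (elim bexE)
    then have ?C by auto
    then show ?thesis by simp
  qed simp_all
qed

lemma family_edges_restrict_10:
  assumes "1 \<le> n"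
  shows "suffix_image [True, False] e \<in> family_edges (path_family \<alpha> (Suc n) (Suc n)) \<longleftrightarrow>
    e \<in> family_edges (path_family \<alpha> n n)"
proof
  assume "suffix_image [True, False] e \<in> family_edges (path_family \<alpha> (Suc n) (Suc n))"
  moreover have "suffix_image [True, False] e \<notin> suffix_image [True, True] ` (`) f ` family_edges (path_family \<alpha> n n)" for f
    by (rule suffix_image_not_mem) (simp_all only: family_edges_image_nonempty, simp_all)
  ultimately have "suffix_image [True, False] e \<in> suffix_image [True, False] ` family_edges (path_family \<alpha> n n)"
    using family_edges_middle_step[OF assms, of "suffix_image [True, False] e" \<alpha>] by auto
  then show "e \<in> family_edges (path_family \<alpha> n n)"
    unfolding suffix_image_mem_iff .
next
  assume "e \<in> family_edges (path_family \<alpha> n n)"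
  then show "suffix_image [True, False] e \<in> family_edges (path_family \<alpha> (Suc n) (Suc n))"
    unfolding path_family_middle_step[OF assms] family_edges_Un family_edges_append by simp
qed

text \<open>The edges inside suffix 11 are the ones that reveal the parameter of this step.\<close>

lemma family_edges_restrict_11:
  assumes "1 \<le> n"
  shows "suffix_image [True, True] e \<in> family_edges (path_family \<alpha> (Suc n) (Suc n)) \<longleftrightarrow>
    e \<in> (`) (f_map (\<alpha> (2 * n))) ` family_edges (path_family \<alpha> n n)"
proof
  assume "suffix_image [True, True] e \<in> family_edges (path_family \<alpha> (Suc n) (Suc n))"
  moreover have "suffix_image [True, True] e \<notin> suffix_image [True, False] ` family_edges (path_family \<alpha> n n)"
    by (rule suffix_image_not_mem) (simp_all only: family_edges_nonempty, simp_all)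
  ultimately have "suffix_image [True, True] e \<in>
      suffix_image [True, True] ` (`) (f_map (\<alpha> (2 * n))) ` family_edges (path_family \<alpha> n n)"
    using family_edges_middle_step[OF assms, of "suffix_image [True, True] e" \<alpha>] by auto
  then show "e \<in> (`) (f_map (\<alpha> (2 * n))) ` family_edges (path_family \<alpha> n n)"
    unfolding suffix_image_mem_iff .
next
  interpret compatible_system "\<alpha> (2 * n)" "path_family \<alpha> n n"
    using compatible_system_path_family[OF assms] .
  assume "e \<in> (`) (f_map (\<alpha> (2 * n))) ` family_edges (path_family \<alpha> n n)"
  then show "suffix_image [True, True] e \<in> family_edges (path_family \<alpha> (Suc n) (Suc n))"
    unfolding path_family_middle_step[OF assms] family_edges_Un new_paths_of_eq family_edges_linked by simp
qed

text \<open>Mixed suffixes rule out both copies, and the remaining edges have no end with suffix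
  10.\<close>

lemma family_edges_no_10_11:
  assumes "1 \<le> n"
  shows "{u @ [True, False], v @ [True, True]} \<notin> family_edges (path_family \<alpha> (Suc n) (Suc n))" (is "?e \<notin> _")
proof
  assume "?e \<in> family_edges (path_family \<alpha> (Suc n) (Suc n))"
  moreover have "?e \<notin> suffix_image [True, False] ` X" "?e \<notin> suffix_image [True, True] ` X" for X
  proof -
    have "?e \<noteq> suffix_image [True, False] e" "?e \<noteq> suffix_image [True, True] e" for e
      by (auto dest!: equalityD1)
    then show "?e \<notin> suffix_image [True, False] ` X" "?e \<notin> suffix_image [True, True] ` X"
      by (meson imageE)+
  qed
  ultimately show False
    using family_edges_middle_step[OF assms, of ?e \<alpha>] by (meson insertI1)
qed

section \<open>Rigidity of the edge sets under block swaps\<close>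

lemma swap_pairs_snoc: "length w = 2 * length \<gamma> \<Longrightarrow> swap_pairs \<gamma> (w @ [c]) = swap_pairs \<gamma> w @ [c]"
proof (induction \<gamma> arbitrary: w)
  case (Cons a \<gamma>)
  then obtain x y zs where "w = x # y # zs" by (cases w; cases "tl w") auto
  then show ?case using Cons by simp
qed simp

text \<open>When two bits are appended, the new parameter bit acts on the block formed by the old
  last bit \<open>c\<close> and the first new bit \<open>y\<close>, while \<open>z\<close> becomes
  the left-over last position.\<close>

lemma swap_pairs_snoc3:
  "length w = 2 * length \<gamma> \<Longrightarrow> swap_pairs (\<gamma> @ [b]) (w @ [c, y, z]) =
    swap_pairs \<gamma> w @ (if b then [y, c, z] else [c, y, z])"
proof (induction \<gamma> arbitrary: w)
  case (Cons a \<gamma>)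
  then obtain x' y' zs where "w = x' # y' # zs" by (cases w; cases "tl w") auto
  then show ?case using Cons by simp
qed simp

lemma pi_map_snoc:
  "length u = Suc (2 * length \<gamma>) \<Longrightarrow> pi_map \<gamma> (u @ [c]) = pi_map \<gamma> u @ [c]"
  by (cases u) (auto simp: swap_pairs_snoc)

lemma pi_map_snoc3:
  "length u = Suc (2 * length \<gamma>) \<Longrightarrow> pi_map (\<gamma> @ [b]) (u @ [c, y, z]) =
    pi_map \<gamma> u @ (if b then [y, c, z] else [c, y, z])"
  by (cases u) (auto simp: swap_pairs_snoc3)

lemma family_edges_length:
  assumes "1 \<le> n" "e \<in> family_edges (path_family \<alpha> n n)" "v \<in> e"
  shows "length v = 2 * n"
proof -
  obtain p where p: "p \<in> path_family \<alpha> n n" "e \<in> path_edges p"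
    using assms(2) unfolding family_edges_iff by (elim bexE)
  then have "v \<in> set p" using path_edges_subset assms(3) by blast
  then show ?thesis
    using layer_family_path_family[OF assms(1) order_refl, of \<alpha>] p
    by (auto simp: layer_family_def in_layer_def)
qed

lemma separating_edge:
  assumes "1 \<le> n" "length \<gamma> = n - 1" "length \<gamma>' = n - 1"
  shows "\<exists>e. pi_map (\<gamma> @ [True]) ` e \<in> family_edges (path_family \<alpha> (Suc n) (Suc n)) \<and>
    pi_map (\<gamma>' @ [False]) ` e \<notin> family_edges (path_family \<alpha> (Suc n) (Suc n))"
proof -
  interpret compatible_system "\<alpha> (2 * n)" "path_family \<alpha> n n"
    using compatible_system_path_family[OF assms(1)] .
  obtain t where t: "t @ [True] \<in> second_set n n"
    using second_set_ends_in_one[of "n - 1"] assms(1) by auto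
  then have len: "length t = Suc (2 * length \<gamma>)" "length (pi_map \<gamma> t) = Suc (2 * length \<gamma>')"
    using assms by (auto simp: second_set_def)
  have "t @ [True] \<in> (\<lambda>p. p ! 1) ` path_family \<alpha> n n"
    using layer_family_path_family[OF assms(1) order_refl, of \<alpha>] t by (simp add: layer_family_def)
  then obtain p where "p \<in> path_family \<alpha> n n" "p ! 1 = t @ [True]" by auto
  then have "{t @ [True, False, False], t @ [True, False, True]} \<in> M_S (path_family \<alpha> n n)"
    unfolding M_S_iff by (intro bexI[of _ p]) auto
  then have edge: "{t @ [True, False, False], t @ [True, False, True]} \<in>
      family_edges (path_family \<alpha> (Suc n) (Suc n))"
    unfolding path_family_middle_step[OF assms(1)] family_edges_Un new_paths_of_eq family_edges_linked
    by simp
  \<comment> \<open>As the swaps are involutions, taking the image of a known \<open>M_S\<close>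
    edge makes the first membership immediate. Its two words now end in 010 and 011, which a final
    parameter bit 0 leaves alone.\<close>
  let ?e = "pi_map (\<gamma> @ [True]) ` {t @ [True, False, False], t @ [True, False, True]}"
  have "?e = {pi_map \<gamma> t @ [False, True, False], pi_map \<gamma> t @ [False, True, True]}"
    using len(1) by (simp add: pi_map_snoc3)
  then have "pi_map (\<gamma>' @ [False]) ` ?e =
      {(pi_map \<gamma>' (pi_map \<gamma> t) @ [False]) @ [True, False], (pi_map \<gamma>' (pi_map \<gamma> t) @ [False]) @ [True, True]}"
    using len(2) by (simp add: pi_map_snoc3)
  then have "pi_map (\<gamma>' @ [False]) ` ?e \<notin> family_edges (path_family \<alpha> (Suc n) (Suc n))"
    using family_edges_no_10_11[OF assms(1)] by metis
  moreover have "pi_map (\<gamma> @ [True]) ` ?e \<in> family_edges (path_family \<alpha> (Suc n) (Suc n))"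
    using edge by (simp add: image_image)
  ultimately show ?thesis by blast
qed

text \<open>The hypothesis compares preimages of the edge set, which are also images because the
  swaps are involutions. The induction removes the last parameter bit.\<close>

lemma family_edges_rigid:
  assumes "1 \<le> n" "length \<beta> = n - 1" "length \<beta>' = n - 1"
    and "\<And>e. pi_map \<beta> ` e \<in> family_edges (path_family \<alpha> n n) \<longleftrightarrow>
      pi_map \<beta>' ` e \<in> family_edges (path_family \<alpha> n n)"
  shows "\<beta> = \<beta>'"
  using assms
proof (induction n arbitrary: \<beta> \<beta>' rule: nat_induct_at_least)
  case (Suc n)
  have "\<beta> \<noteq> []" "\<beta>' \<noteq> []" using Suc.prems Suc.hyps by auto
  then obtain \<gamma> b \<gamma>' b' where \<beta>: "\<beta> = \<gamma> @ [b]" "\<beta>' = \<gamma>' @ [b']"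
    by (metis rev_exhaust)
  have len: "length \<gamma> = n - 1" "length \<gamma>' = n - 1" using Suc.prems \<beta> by auto
  note same = Suc.prems(3)[unfolded \<beta>]
  \<comment> \<open>If the bits differ, \<open>separating_edge\<close>, with the parameters in the
    appropriate order, contradicts the hypothesis.\<close>
  have "b = b'"
    using separating_edge[OF Suc.hyps len, of \<alpha>] separating_edge[OF Suc.hyps len(2,1), of \<alpha>] same
    by (cases b; cases b') (auto; metis)+
  \<comment> \<open>\<open>lift v\<close> is \<open>v\<close> with suffix 10 after undoing the swap
    prescribed by the last parameter bit \<open>b\<close>; the remaining bits then act on
    \<open>v\<close> alone.\<close>
  define lift where "lift v = butlast v @ (if b then [True, last v, False] else [last v, True, False])"
    for v :: bits
  have lift: "pi_map (\<delta> @ [b]) (lift v) = pi_map \<delta> v @ [True, False]"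
    if "length v = 2 * n" "length \<delta> = n - 1" for v \<delta>
  proof -
    have v: "v = butlast v @ [last v]" using that Suc.hyps by (cases v) auto
    have l: "length (butlast v) = Suc (2 * length \<delta>)" using that Suc.hyps by simp
    show ?thesis
      unfolding lift_def using pi_map_snoc3[OF l] pi_map_snoc[OF l, of "last v"] v by simp
  qed
  have restrict: "pi_map \<delta> ` e \<in> family_edges (path_family \<alpha> n n) \<longleftrightarrow>
      pi_map (\<delta> @ [b]) ` lift ` e \<in> family_edges (path_family \<alpha> (Suc n) (Suc n))"
    if "\<forall>v\<in>e. length v = 2 * n" "length \<delta> = n - 1" for e \<delta>
  proof -
    have "pi_map (\<delta> @ [b]) ` lift ` e = suffix_image [True, False] (pi_map \<delta> ` e)"
      unfolding image_image using that lift by (intro image_cong) auto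
    then show ?thesis using family_edges_restrict_10[OF Suc.hyps] by simp
  qed
  have "pi_map \<gamma> ` e \<in> family_edges (path_family \<alpha> n n) \<longleftrightarrow>
      pi_map \<gamma>' ` e \<in> family_edges (path_family \<alpha> n n)" for e
  proof (cases "\<forall>v\<in>e. length v = 2 * n")
    case True
    then show ?thesis using restrict len same \<open>b = b'\<close> by simp
  next
    case False
    then have "pi_map \<delta> ` e \<notin> family_edges (path_family \<alpha> n n)" for \<delta>
      using family_edges_length[OF Suc.hyps] by (metis imageI length_pi_map)
    then show ?thesis by simp
  qed
  then show ?case using Suc.IH len \<beta> \<open>b = b'\<close> by blast
qed simp

text \<open>Reversed complementation is injective and common to all maps f, so cancelling it turns
  the equation into the hypothesis of \<open>family_edges_rigid\<close>.\<close>

lemma f_map_image_family_edges_inject: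
  assumes "1 \<le> n" "length \<beta> = n - 1" "length \<beta>' = n - 1"
    and eq: "(`) (f_map \<beta>) ` family_edges (path_family \<alpha> n n) = (`) (f_map \<beta>') ` family_edges (path_family \<alpha> n n)"
  shows "\<beta> = \<beta>'"
proof (rule family_edges_rigid[OF assms(1-3)])
  let ?E = "family_edges (path_family \<alpha> n n)"
  have pi_map_image: "pi_map \<gamma> ` pi_map \<gamma> ` e = e" for \<gamma> e by (simp add: image_image)
  have f_map_image: "f_map \<gamma> ` e = (\<lambda>x. map Not (rev x)) ` pi_map \<gamma> ` e" for \<gamma> e
    by (simp add: image_image f_map_def)
  have transfer: "pi_map \<gamma>' ` e \<in> ?E"
    if "(`) (f_map \<gamma>) ` ?E = (`) (f_map \<gamma>') ` ?E" "pi_map \<gamma> ` e \<in> ?E" for \<gamma> \<gamma>' e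
  proof -
    have "f_map \<gamma> ` pi_map \<gamma> ` e \<in> (`) (f_map \<gamma>') ` ?E" using that by blast
    then obtain e' where e': "e' \<in> ?E" "f_map \<gamma> ` pi_map \<gamma> ` e = f_map \<gamma>' ` e'" by (elim imageE)
    then have "e = pi_map \<gamma>' ` e'"
      unfolding f_map_image pi_map_image inj_image_eq_iff[OF inj_map_Not_rev] by simp
    then show ?thesis using e'(1) pi_map_image by simp
  qed
  show "pi_map \<beta> ` e \<in> ?E \<longleftrightarrow> pi_map \<beta>' ` e \<in> ?E" for e
    using transfer[OF eq] transfer[OF eq[symmetric]] by blast
qed

text \<open>Suffix 10 yields equal earlier edge sets and hence, inductively, equal earlier
  parameters and families. Suffix 11 then yields equal images of one edge set, and rigidity gives
  the last parameter.\<close>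

lemma parameters_recoverable:
  assumes "1 \<le> n" "\<forall>i\<in>{1..<n}. length (\<alpha> (2 * i)) = i - 1" "\<forall>i\<in>{1..<n}. length (\<alpha>' (2 * i)) = i - 1"
    and "family_edges (path_family \<alpha> n n) = family_edges (path_family \<alpha>' n n)"
  shows "\<forall>i\<in>{1..<n}. \<alpha> (2 * i) = \<alpha>' (2 * i)"
  using assms
proof (induction n rule: nat_induct_at_least)
  case (Suc n)
  have "family_edges (path_family \<alpha> n n) = family_edges (path_family \<alpha>' n n)"
    using family_edges_restrict_10[OF Suc.hyps] Suc.prems(3) by blast
  then have IH: "\<forall>i\<in>{1..<n}. \<alpha> (2 * i) = \<alpha>' (2 * i)"
    using Suc.IH Suc.prems(1,2) by simp
  then have "path_family \<alpha>' n n = path_family \<alpha> n n"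
    by (metis path_family_cong)
  then have "e \<in> (`) (f_map (\<alpha> (2 * n))) ` family_edges (path_family \<alpha> n n) \<longleftrightarrow>
      e \<in> (`) (f_map (\<alpha>' (2 * n))) ` family_edges (path_family \<alpha> n n)" for e
    using family_edges_restrict_11[OF Suc.hyps, of e \<alpha>] family_edges_restrict_11[OF Suc.hyps, of e \<alpha>']
      Suc.prems(3) by metis
  then have "(`) (f_map (\<alpha> (2 * n))) ` family_edges (path_family \<alpha> n n) =
      (`) (f_map (\<alpha>' (2 * n))) ` family_edges (path_family \<alpha> n n)"
    by (rule set_eqI)
  then have "\<alpha> (2 * n) = \<alpha>' (2 * n)"
    using f_map_image_family_edges_inject Suc.hyps Suc.prems(1,2) by simp
  then show ?case using IH by (auto simp: less_Suc_eq)
qed simp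

text \<open>Edges of \<open>M_FL\<close> change the last bit, so edges with constant last bit come
  from exactly one of the two copies.\<close>

lemma edges_factor_of_restrict:
  assumes "compatible_system \<alpha> \<P>"
  shows "suffix_image [False] e \<in> edges (factor_of \<alpha> \<P>) \<longleftrightarrow> e \<in> family_edges \<P>"
    and "suffix_image [True] e \<in> edges (factor_of \<alpha> \<P>) \<longleftrightarrow> e \<in> (`) (f_map \<alpha>) ` family_edges \<P>"
proof -
  interpret compatible_system \<alpha> \<P> by fact
  have M: "suffix_image [b] e \<notin> M_FL \<P>" for b
  proof
    assume "suffix_image [b] e \<in> M_FL \<P>"
    then obtain v where "suffix_image [b] e = {v @ [False], v @ [True]}" by (auto simp: M_FL_def)
    then have "v @ [\<not> b] \<in> suffix_image [b] e" by (cases b) auto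
    then show False by auto
  qed
  have "suffix_image [False] e \<notin> suffix_image [True] ` (`) (f_map \<alpha>) ` family_edges \<P>"
    by (rule suffix_image_not_mem) (simp_all only: family_edges_image_nonempty, simp_all)
  then show "suffix_image [False] e \<in> edges (factor_of \<alpha> \<P>) \<longleftrightarrow> e \<in> family_edges \<P>"
    unfolding edges_factor_of Un_iff suffix_image_mem_iff using M by meson
  have "suffix_image [True] e \<notin> suffix_image [False] ` family_edges \<P>"
    by (rule suffix_image_not_mem) (simp_all only: family_edges_nonempty, simp_all)
  then show "suffix_image [True] e \<in> edges (factor_of \<alpha> \<P>) \<longleftrightarrow> e \<in> (`) (f_map \<alpha>) ` family_edges \<P>"
    unfolding edges_factor_of Un_iff suffix_image_mem_iff using M by meson
qed

theorem theorem6: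
  fixes n :: nat and \<alpha> \<alpha>' :: "nat \<Rightarrow> bool list"
  assumes "n \<ge> 1"
    and "parameter_sequence n \<alpha>"
    and "parameter_sequence n \<alpha>'"
    and "\<exists>i\<in>{1..n}. \<alpha> (2 * i) \<noteq> \<alpha>' (2 * i)"
  shows "two_factor \<alpha> n \<noteq> two_factor \<alpha>' n"
proof
  assume "two_factor \<alpha> n = two_factor \<alpha>' n"
  then have eq: "edges (factor_of (\<alpha> (2 * n)) (path_family \<alpha> n n)) =
      edges (factor_of (\<alpha>' (2 * n)) (path_family \<alpha>' n n))"
    by (simp add: two_factor_def)
  have len: "length (\<alpha> (2 * i)) = i - 1" "length (\<alpha>' (2 * i)) = i - 1" if "i \<in> {1..n}" for i
    using assms(2,3) that by (auto simp: parameter_sequence_def)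
  note restrict = edges_factor_of_restrict[OF compatible_system_path_family[OF assms(1)]]
  have "family_edges (path_family \<alpha> n n) = family_edges (path_family \<alpha>' n n)"
    using restrict(1)[of _ "\<alpha> (2 * n)" \<alpha>] restrict(1)[of _ "\<alpha>' (2 * n)" \<alpha>'] unfolding eq by blast
  then have lower: "\<forall>i\<in>{1..<n}. \<alpha> (2 * i) = \<alpha>' (2 * i)"
    using len by (intro parameters_recoverable[OF assms(1)]) auto
  then have fam: "path_family \<alpha>' n n = path_family \<alpha> n n"
    by (metis path_family_cong)
  \<comment> \<open>The families at level \<open>n\<close> depend only on earlier parameters; the
    last one is visible in the copy with suffix 1.\<close>
  have "e \<in> (`) (f_map (\<alpha> (2 * n))) ` family_edges (path_family \<alpha> n n) \<longleftrightarrow>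
      e \<in> (`) (f_map (\<alpha>' (2 * n))) ` family_edges (path_family \<alpha> n n)" for e
    using restrict(2)[of e "\<alpha> (2 * n)" \<alpha>] restrict(2)[of e "\<alpha>' (2 * n)" \<alpha>'] unfolding eq fam by metis
  then have "(`) (f_map (\<alpha> (2 * n))) ` family_edges (path_family \<alpha> n n) =
      (`) (f_map (\<alpha>' (2 * n))) ` family_edges (path_family \<alpha> n n)"
    by (rule set_eqI)
  then have "\<alpha> (2 * n) = \<alpha>' (2 * n)"
    using f_map_image_family_edges_inject[OF assms(1)] len[of n] assms(1) by simp
  then have "\<alpha> (2 * i) = \<alpha>' (2 * i)" if "i \<in> {1..n}" for i
    using lower that by (cases "i = n") auto
  then show False using assms(4) by blast
qed

end
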